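(* Suppose that a linear partial monitoring game (with domain $\mathcal D$ and Legendre potential $F$ satisfying the standing assumptions in the context) has an information ratio of $(\alpha,\beta,\lambda)$ with $\alpha=0$ and $\lambda\ge2$. Then, for any $n\ge1$ and any finitely supported prior distribution $\mu$ on $\mathcal Z^n$, the Bayesian regret of information-directed sampling (defined in the context, run with prior $\mu$) is bounded by $$\mathfrak{BR}_n\le n\epsilon_{\mathcal D}+\lambda^{1-2/\lambda}(\beta n)^{1-1/\lambda}\operatorname{diam}(\mathcal D)^{1/\lambda}.$$
   Context: A linear partial monitoring game is given by an action set $\mathcal A\subset\mathbb R^d$, a signal set $\Sigma$, a latent set $\mathcal Z$, a signal function $\Phi:\mathcal A\times\mathcal Z\to\Sigma$, written $\Phi_a(z)$, and a loss function $\ell:\mathcal Z\to[0,1]^d$; $\Phi$ and $\ell$ are known to the learner. A policy $\pi$ maps action/signal sequences to distributions over $\mathcal A$. Given $(z_t)_{t=1}^n\in\mathcal Z^n$, in round $t$ the learner samples $A_t$ from the distribution $P_t$ given by $\pi$ from $(A_s)_{s<t}$, $(\sigma_s)_{s<t}$ and observes $\sigma_t=\Phi_{A_t}(z_t)$. The regret is $\mathfrak R_n(\pi,(z_t))=\max_{a\in\mathcal A}\mathbb E[\sum_{t=1}^n\langle A_t-a,\ell(z_t)\rangle]$ and the Bayesian regret is $\mathfrak{BR}_n(\pi,\mu)=\int_{\mathcal Z^n}\mathfrak R_n(\pi,(z_t))\,d\mu((z_t))$. Standing assumptions. $F:\mathbb R^d\to\mathbb R\cup\{\infty\}$ is Legendre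 (proper, convex, lower semi-continuous, essentially smooth and essentially strictly convex). $\mathcal D\subset\operatorname{conv}(\mathcal A)$ is compact, convex and has non-empty relative interior. Moreover: (a) $1<|\mathcal A|<\infty$; (b) $\langle a,\ell(z)\rangle\in[0,1]$ for all $a\in\mathcal A$, $z\in\mathcal Z$; (c) $\mathcal D\subset\operatorname{dom}(F)=\{x:F(x)<\infty\}$; (d) $\operatorname{diam}(\mathcal D)=\sup_{x,y\in\mathcal D}(F(x)-F(y))<\infty$. Notation. $\mathcal P$ is the set of probability distributions on $\mathcal A$, identified with vectors in $\mathbb R^{|\mathcal A|}$. $\operatorname{D}(p,q)=F(p)-F(q)-\langle\nabla F(q),p-q\rangle$ is the Bregman divergence; if $F$ is not differentiable at $q$, then $\langle\nabla F(q),p-q\rangle$ is read as the one-sided directional derivative $\lim_{h\to0^+}(F(q+h(p-q))-F(q))/h$. $\mathcal V$ is the set of finitely supported probability distributions on $\mathcal Z\times\mathcal D$. $\epsilon_{\mathcal D}=\max_{a\in\mathcal A}\min_{b\in\mathcal D}\sup_{z\in\mathcal Z}\langle b-a,\ell(z)\rangle$. Information ratio. For $\alpha\in\mathbb R$, $\beta\ge0$, $\lambda\ge1$, the game has an information ratio of $(\alpha,\beta,\lambda)$ if for any $\nu\in\mathcal V$ there exists $p\in\mathcal P$ such that when $(Z,A^*,A)$ has law $\nu\otimes p$ (i.e. $(Z,A^* )\sim\nu$ and $A\sim p$ independently), $$\mathbb E[\langle A-A^*,\ell(Z)\rangle]\le\alpha+\beta^{1-1/\lambda}\,\big(\mathbb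 E[\operatorname{D}(\mathbb E[A^*\mid\Phi_A(Z),A],\mathbb E[A^*])]\big)^{1/\lambda}.$$ Information-directed sampling with prior $\mu$. Let $(Z_t)_{t=1}^n\sim\mu$ and $A^*=\arg\min_{a\in\mathcal D}\sum_{t=1}^n\langle a,\ell(Z_t)\rangle$ (a fixed selection as a function of $(Z_t)$). In round $t$, let $\mathbb E_{t-1}[\cdot]=\mathbb E[\cdot\mid A_1,\sigma_1,\dots,A_{t-1},\sigma_{t-1}]$, and for $a\in\mathcal A$ let $$\Delta_{t,a}=\mathbb E_{t-1}[\langle a-A^*,\ell(Z_t)\rangle],\qquad \mathfrak I_{t,a}=\mathbb E_{t-1}\big[\operatorname{D}(\mathbb E_{t-1}[A^*\mid\Phi_a(Z_t)],\mathbb E_{t-1}[A^*])\big].$$ The algorithm samples $A_t\sim P_t$, where $$P_t=\arg\min_{p\in\mathcal P}\ \lim_{\epsilon\to0^+}\frac{\max(0,\langle p,\Delta_t\rangle)^2}{\langle p,\mathfrak I_t\rangle+\epsilon},$$ and observes $\sigma_t=\Phi_{A_t}(Z_t)$. *)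

theory Defs
  imports "HOL-Probability.Probability"
begin

definition edom :: "('v \<Rightarrow> ereal) \<Rightarrow> 'v set" where
  "edom F = {x. F x < \<infinity>}"

definition proper_fun :: "('v \<Rightarrow> ereal) \<Rightarrow> bool" where
  "proper_fun F \<longleftrightarrow> (\<forall>x. F x \<noteq> -\<infinity>) \<and> edom F \<noteq> {}"

definition convex_fun :: "('v::real_vector \<Rightarrow> ereal) \<Rightarrow> bool" where
  "convex_fun F \<longleftrightarrow> convex {(x, r :: real). F x \<le> ereal r}"

definition lsc_fun :: "('v::topological_space \<Rightarrow> ereal) \<Rightarrow> bool" where
  "lsc_fun F \<longleftrightarrow> (\<forall>x. F x \<le> Liminf (at x) F)"

text \<open>
  Because \<open>real_of_ereal \<infinity> = 0\<close>, the real-valued function below represents \<open>F\<close> near \<open>x\<close> only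
  when \<open>x\<close> is interior to the domain; differentiability is therefore restricted to such points.
\<close>

definition has_gradient :: "('v::real_inner \<Rightarrow> ereal) \<Rightarrow> 'v \<Rightarrow> 'v \<Rightarrow> bool" where
  "has_gradient F x g \<longleftrightarrow> x \<in> interior (edom F) \<and> (GDERIV (\<lambda>y. real_of_ereal (F y)) x :> g)"

definition gradient :: "('v::real_inner \<Rightarrow> ereal) \<Rightarrow> 'v \<Rightarrow> 'v" where
  "gradient F x = (THE g. has_gradient F x g)"

definition subdifferential :: "('v::real_inner \<Rightarrow> ereal) \<Rightarrow> 'v \<Rightarrow> 'v set" where
  "subdifferential F x = {g. \<forall>y. F x + ereal (g \<bullet> (y - x)) \<le> F y}"

text \<open>Essential smoothness and essential strict convexity are those of Rockafellar's
  Convex Analysis, Section 26.\<close>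

definition essentially_smooth :: "('v::real_inner \<Rightarrow> ereal) \<Rightarrow> bool" where
  "essentially_smooth F \<longleftrightarrow>
     interior (edom F) \<noteq> {} \<and>
     (\<forall>x \<in> interior (edom F). \<exists>g. has_gradient F x g) \<and>
     (\<forall>X x. (\<forall>k. X k \<in> interior (edom F)) \<longrightarrow> x \<in> frontier (interior (edom F)) \<longrightarrow>
        X \<longlonglongrightarrow> x \<longrightarrow> filterlim (\<lambda>k. norm (gradient F (X k))) at_top sequentially)"

definition strictly_convex_fun_on :: "'v::real_vector set \<Rightarrow> ('v \<Rightarrow> ereal) \<Rightarrow> bool" where
  "strictly_convex_fun_on C F \<longleftrightarrow>
     (\<forall>x \<in> C. \<forall>y \<in> C. \<forall>u::real. x \<noteq> y \<longrightarrow> 0 < u \<longrightarrow> u < 1 \<longrightarrow>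
        F ((1 - u) *\<^sub>R x + u *\<^sub>R y) < ereal (1 - u) * F x + ereal u * F y)"

definition essentially_strictly_convex :: "('v::real_inner \<Rightarrow> ereal) \<Rightarrow> bool" where
  "essentially_strictly_convex F \<longleftrightarrow>
     (\<forall>C. convex C \<longrightarrow> C \<subseteq> {x. subdifferential F x \<noteq> {}} \<longrightarrow> strictly_convex_fun_on C F)"

definition legendre :: "('v::real_inner \<Rightarrow> ereal) \<Rightarrow> bool" where
  "legendre F \<longleftrightarrow> proper_fun F \<and> convex_fun F \<and> lsc_fun F \<and>
     essentially_smooth F \<and> essentially_strictly_convex F"

definition dir_deriv :: "('v::real_vector \<Rightarrow> ereal) \<Rightarrow> 'v \<Rightarrow> 'v \<Rightarrow> ereal" where
  "dir_deriv F q v = Lim (at_right 0) (\<lambda>h::real. (F (q + h *\<^sub>R v) - F q) / ereal h)"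

definition bregman :: "('v::real_inner \<Rightarrow> ereal) \<Rightarrow> 'v \<Rightarrow> 'v \<Rightarrow> ereal" where
  "bregman F p q = F p - F q -
     (if \<exists>g. has_gradient F q g then ereal (gradient F q \<bullet> (p - q)) else dir_deriv F q (p - q))"

definition potential_diam :: "('v \<Rightarrow> ereal) \<Rightarrow> 'v set \<Rightarrow> ereal" where
  "potential_diam F D = (SUP (x, y) \<in> D \<times> D. F x - F y)"

text \<open>
  The value at \<open>\<omega>\<close> of the conditional expectation of \<open>X\<close> given \<open>Y\<close>, meaningful
  for \<open>\<omega>\<close> in the support of \<open>M\<close>, where the conditioning event has positive probability.
\<close>

definition cond_exp_pmf :: "'w pmf \<Rightarrow> ('w \<Rightarrow> 'v::{banach, second_countable_topology}) \<Rightarrow>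
    ('w \<Rightarrow> 'y) \<Rightarrow> 'w \<Rightarrow> 'v" where
  "cond_exp_pmf M X Y \<omega> = measure_pmf.expectation (cond_pmf M {\<omega>'. Y \<omega>' = Y \<omega>}) X"

text \<open>
  A game has a finite action set \<open>A\<close>, a latent set \<open>Z\<close>, a signal function \<open>\<Phi>\<close> with values in the
  type \<open>'s\<close> and a loss function \<open>loss\<close>; \<open>D\<close> is the domain and \<open>F\<close> the potential.
  Rounds are numbered from 0, and a history of length \<open>t\<close> lists the action/signal pairs
  of the rounds before round \<open>t\<close>, oldest first.
\<close>

definition approx_error :: "'v::real_inner set \<Rightarrow> 'z set \<Rightarrow> ('z \<Rightarrow> 'v) \<Rightarrow> 'v set \<Rightarrow> real" where
  "approx_error A Z loss D = Max ((\<lambda>a. INF b \<in> D. SUP z \<in> Z. (b - a) \<bullet> loss z) ` A)"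
  \<comment> \<open>The infimum is attained: \<open>D\<close> is compact and the supremum is lower semi-continuous in \<open>b\<close>.\<close>

type_synonym ('v, 's) policy = "('v \<times> 's) list \<Rightarrow> 'v pmf"

definition is_policy :: "'v set \<Rightarrow> ('v, 's) policy \<Rightarrow> bool" where
  "is_policy A \<pi> \<longleftrightarrow> (\<forall>h. fst ` set h \<subseteq> A \<longrightarrow> set_pmf (\<pi> h) \<subseteq> A)"

primrec history_pmf :: "('v \<Rightarrow> 'z \<Rightarrow> 's) \<Rightarrow> ('v, 's) policy \<Rightarrow> 'z list \<Rightarrow> nat \<Rightarrow> ('v \<times> 's) list pmf" where
  "history_pmf \<Phi> \<pi> zs 0 = return_pmf []"
| "history_pmf \<Phi> \<pi> zs (Suc t) =
     bind_pmf (history_pmf \<Phi> \<pi> zs t) (\<lambda>h. map_pmf (\<lambda>a. h @ [(a, \<Phi> a (zs ! t))]) (\<pi> h))"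

definition regret ::
  "'v::euclidean_space set \<Rightarrow> ('v \<Rightarrow> 'z \<Rightarrow> 's) \<Rightarrow> ('z \<Rightarrow> 'v) \<Rightarrow> ('v, 's) policy \<Rightarrow> 'z list \<Rightarrow> real" where
  "regret A \<Phi> loss \<pi> zs =
     Max ((\<lambda>a. measure_pmf.expectation (history_pmf \<Phi> \<pi> zs (length zs))
                 (\<lambda>h. \<Sum>t<length zs. (fst (h ! t) - a) \<bullet> loss (zs ! t))) ` A)"

definition bayes_regret ::
  "'v::euclidean_space set \<Rightarrow> ('v \<Rightarrow> 'z \<Rightarrow> 's) \<Rightarrow> ('z \<Rightarrow> 'v) \<Rightarrow> ('v, 's) policy \<Rightarrow> 'z list pmf \<Rightarrow> real" where
  "bayes_regret A \<Phi> loss \<pi> \<mu> = measure_pmf.expectation \<mu> (regret A \<Phi> loss \<pi>)"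

text \<open>
  In \<open>has_info_ratio\<close> and \<open>info_gain\<close>, \<open>real_of_ereal\<close> is applied only to finite Bregman divergences.
  For a finitely supported law with \<open>A*\<close> in \<open>D\<close>, the point \<open>q = E[A*]\<close> is a convex combination, with
  positive weight on \<open>p\<close>, of a conditional mean \<open>p\<close> and another point of \<open>D\<close>; the one-sided derivative
  of the convex function \<open>F\<close> at \<open>q\<close> in the direction \<open>p - q\<close> is then finite.
\<close>

definition has_info_ratio ::
  "'v::euclidean_space set \<Rightarrow> 'z set \<Rightarrow> ('v \<Rightarrow> 'z \<Rightarrow> 's) \<Rightarrow> ('z \<Rightarrow> 'v) \<Rightarrow> ('v \<Rightarrow> ereal) \<Rightarrow> 'v set \<Rightarrow>
    real \<Rightarrow> real \<Rightarrow> real \<Rightarrow> bool" where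
  "has_info_ratio A Z \<Phi> loss F D \<alpha> \<beta> l \<longleftrightarrow>
     (\<forall>\<nu> :: ('z \<times> 'v) pmf. finite (set_pmf \<nu>) \<and> set_pmf \<nu> \<subseteq> Z \<times> D \<longrightarrow>
       (\<exists>p. set_pmf p \<subseteq> A \<and>
         (let M = pair_pmf \<nu> p;
              Astar = (\<lambda>((z, b), a). b);
              obs = (\<lambda>((z, b), a). (\<Phi> a z, a))
          in measure_pmf.expectation M (\<lambda>((z, b), a). (a - b) \<bullet> loss z)
             \<le> \<alpha> + (if l = 1 then 1 else \<beta> powr (1 - 1 / l)) *
                 measure_pmf.expectation M
                   (\<lambda>\<omega>. real_of_ereal
                      (bregman F (cond_exp_pmf M Astar obs \<omega>) (measure_pmf.expectation M Astar)))
                   powr (1 / l))))"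
  \<comment> \<open>The case \<open>l = 1\<close> is separate because \<open>0 powr 0 = 0\<close>, while \<open>0\<^sup>0\<close> is read as \<open>1\<close>.\<close>

definition joint_pmf ::
  "('v \<Rightarrow> 'z \<Rightarrow> 's) \<Rightarrow> 'z list pmf \<Rightarrow> ('v, 's) policy \<Rightarrow> nat \<Rightarrow> ('z list \<times> ('v \<times> 's) list) pmf" where
  "joint_pmf \<Phi> \<mu> \<pi> t = bind_pmf \<mu> (\<lambda>zs. map_pmf (Pair zs) (history_pmf \<Phi> \<pi> zs t))"

text \<open>The conditional law of the latent sequence given the history \<open>h\<close>; it realises
  \<open>E\<^sub>t\<^sub>-\<^sub>1\<close> on the event that \<open>h\<close> is the observed history.\<close>

definition posterior ::
  "('v \<Rightarrow> 'z \<Rightarrow> 's) \<Rightarrow> 'z list pmf \<Rightarrow> ('v, 's) policy \<Rightarrow> ('v \<times> 's) list \<Rightarrow> 'z list pmf" where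
  "posterior \<Phi> \<mu> \<pi> h = map_pmf fst (cond_pmf (joint_pmf \<Phi> \<mu> \<pi> (length h)) {\<omega>. snd \<omega> = h})"

definition exp_gap ::
  "('z \<Rightarrow> 'v::euclidean_space) \<Rightarrow> ('z list \<Rightarrow> 'v) \<Rightarrow> 'z list pmf \<Rightarrow> nat \<Rightarrow> 'v \<Rightarrow> real" where
  "exp_gap loss Astar Q t a = measure_pmf.expectation Q (\<lambda>zs. (a - Astar zs) \<bullet> loss (zs ! t))"

definition info_gain ::
  "('v::euclidean_space \<Rightarrow> 'z \<Rightarrow> 's) \<Rightarrow> ('v \<Rightarrow> ereal) \<Rightarrow> ('z list \<Rightarrow> 'v) \<Rightarrow> 'z list pmf \<Rightarrow> nat \<Rightarrow> 'v \<Rightarrow> real" where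
  "info_gain \<Phi> F Astar Q t a = measure_pmf.expectation Q
     (\<lambda>zs. real_of_ereal (bregman F (cond_exp_pmf Q Astar (\<lambda>zs'. \<Phi> a (zs' ! t)) zs)
                                    (measure_pmf.expectation Q Astar)))"

definition ids_objective :: "'v set \<Rightarrow> ('v \<Rightarrow> real) \<Rightarrow> ('v \<Rightarrow> real) \<Rightarrow> 'v pmf \<Rightarrow> ereal" where
  "ids_objective A \<Delta> I p =
     Lim (at_right 0) (\<lambda>\<epsilon>::real.
       ereal ((max 0 (\<Sum>a\<in>A. pmf p a * \<Delta> a))\<^sup>2 / ((\<Sum>a\<in>A. pmf p a * I a) + \<epsilon>)))"

text \<open>
  \<open>A*\<close> is given by a selection \<open>Astar\<close> of minimisers. At every history that occurs with positive
  probability, the policy plays a minimiser of the objective, with ties broken arbitrarily.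
\<close>

definition optimal_selection ::
  "'z set \<Rightarrow> ('z \<Rightarrow> 'v::real_inner) \<Rightarrow> 'v set \<Rightarrow> nat \<Rightarrow> ('z list \<Rightarrow> 'v) \<Rightarrow> bool" where
  "optimal_selection Z loss D n Astar \<longleftrightarrow>
     (\<forall>zs. length zs = n \<and> set zs \<subseteq> Z \<longrightarrow>
        is_arg_min (\<lambda>a. \<Sum>t<n. a \<bullet> loss (zs ! t)) (\<lambda>a. a \<in> D) (Astar zs))"

definition is_ids ::
  "'v::euclidean_space set \<Rightarrow> ('v \<Rightarrow> 'z \<Rightarrow> 's) \<Rightarrow> ('z \<Rightarrow> 'v) \<Rightarrow> ('v \<Rightarrow> ereal) \<Rightarrow> ('z list \<Rightarrow> 'v) \<Rightarrow> nat \<Rightarrow>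
    'z list pmf \<Rightarrow> ('v, 's) policy \<Rightarrow> bool" where
  "is_ids A \<Phi> loss F Astar n \<mu> \<pi> \<longleftrightarrow>
     is_policy A \<pi> \<and>
     (\<forall>t<n. \<forall>h \<in> snd ` set_pmf (joint_pmf \<Phi> \<mu> \<pi> t).
        let Q = posterior \<Phi> \<mu> \<pi> h
        in is_arg_min (ids_objective A (exp_gap loss Astar Q t) (info_gain \<Phi> F Astar Q t))
             (\<lambda>p. set_pmf p \<subseteq> A) (\<pi> h))"

end

theory Submission
  imports Defs
begin

text \<open>
  In each round, the minimiser \<open>p\<close> of the squared-gap-to-information ratio is compared with a
  distribution \<open>q\<close> from the information ratio condition for the posterior. First-order optimality
  along the segment from \<open>p\<close> to \<open>q\<close> gives \<open>\<langle>p, \<Delta>\<rangle> \<le> 2 \<langle>q, \<Delta>\<rangle>\<close>, and hence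
  \<open>\<langle>p, \<Delta>\<rangle> \<le> 2 powr (1 - 2 / l) * \<beta> powr (1 - 1 / l) * \<langle>p, I\<rangle> powr (1 / l)\<close>. Summing over the
  rounds and using concavity of the power function leaves the total information gain. The expected
  Bregman divergence from a mean to its conditional means is at most the expected increase of the
  potential there, so the total telescopes and is at most the diameter. The loss of restricting the
  comparator to \<open>D\<close> is absorbed by the approximation error.
\<close>

subsection \<open>Bregman divergences of conditional means\<close>

lemma edom_finite:
  assumes "proper_fun F" "x \<in> edom F"
  shows "F x = ereal (real_of_ereal (F x))"
  using assms by (cases "F x") (auto simp: proper_fun_def edom_def)

lemma convex_fun_imp_convex_on:
  assumes "proper_fun F" "convex_fun F" "convex D" "D \<subseteq> edom F"
  shows "convex_on D (\<lambda>x. real_of_ereal (F x))"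
proof (rule convex_onI)
  fix t :: real and x y
  assume t: "0 < t" "t < 1" and xy: "x \<in> D" "y \<in> D"
  define f where "f x = real_of_ereal (F x)" for x
  have fin: "F z = ereal (f z)" if "z \<in> D" for z
    using edom_finite[OF assms(1)] that assms(4) unfolding f_def by blast
  have "(1 - t) *\<^sub>R (x, f x) + t *\<^sub>R (y, f y) \<in> {(x, r). F x \<le> ereal r}"
    by (rule convexD[OF assms(2)[unfolded convex_fun_def]]) (use t xy fin in auto)
  moreover have "(1 - t) *\<^sub>R x + t *\<^sub>R y \<in> D"
    using assms(3) t xy by (simp add: convex_alt)
  ultimately have "f ((1 - t) *\<^sub>R x + t *\<^sub>R y) \<le> (1 - t) * f x + t * f y"
    using fin by simp
  thus "real_of_ereal (F ((1 - t) *\<^sub>R x + t *\<^sub>R y))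
      \<le> (1 - t) * real_of_ereal (F x) + t * real_of_ereal (F y)"
    by (simp add: f_def)
qed (use assms in simp)

section \<open>One-sided difference quotients of convex functions\<close>

lemma convex_on_difference_quotient_mono:
  fixes f :: "'v::real_vector \<Rightarrow> real"
  assumes f: "convex_on D f" and D: "q \<in> D" "q + k *\<^sub>R v \<in> D" and hk: "0 < h" "h \<le> k"
  shows "(f (q + h *\<^sub>R v) - f q) / h \<le> (f (q + k *\<^sub>R v) - f q) / k"
proof -
  have eq: "q + h *\<^sub>R v = (1 - h/k) *\<^sub>R q + (h/k) *\<^sub>R (q + k *\<^sub>R v)"
    using hk by (simp add: algebra_simps)
  have "f (q + h *\<^sub>R v) \<le> (1 - h/k) * f q + (h/k) * f (q + k *\<^sub>R v)"
    unfolding eq by (rule convex_onD[OF f]) (use hk D in auto)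
  thus ?thesis using hk by (simp add: field_simps)
qed

text \<open>The point \<open>q\<close> is a convex combination of \<open>q + h v\<close> and
  \<open>q - \<delta> v\<close>, with weights proportional to \<open>\<delta>\<close> and
  \<open>h\<close>. A backward quotient thus bounds every forward quotient from below, which rules
  out a one-sided derivative of minus infinity.\<close>

lemma convex_on_difference_quotient_lower:
  fixes f :: "'v::real_vector \<Rightarrow> real"
  assumes f: "convex_on D f" and D: "q + h *\<^sub>R v \<in> D" "q - \<delta> *\<^sub>R v \<in> D" and "0 < h" "0 < \<delta>"
  shows "(f q - f (q - \<delta> *\<^sub>R v)) / \<delta> \<le> (f (q + h *\<^sub>R v) - f q) / h"
proof -
  let ?t = "h / (\<delta> + h)"
  have t: "1 - ?t = \<delta> / (\<delta> + h)"
    using assms by (simp add: field_simps)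
  have "(1 - u) *\<^sub>R (q + h *\<^sub>R v) + u *\<^sub>R (q - \<delta> *\<^sub>R v) = q + ((1 - u) * h - u * \<delta>) *\<^sub>R v" for u
    by (simp add: algebra_simps)
  from this[of ?t] have "(1 - ?t) *\<^sub>R (q + h *\<^sub>R v) + ?t *\<^sub>R (q - \<delta> *\<^sub>R v)
      = q + ((1 - ?t) * h - ?t * \<delta>) *\<^sub>R v" .
  also have "(1 - ?t) * h - ?t * \<delta> = 0"
    unfolding t using assms by (simp add: field_simps)
  finally have q: "(1 - ?t) *\<^sub>R (q + h *\<^sub>R v) + ?t *\<^sub>R (q - \<delta> *\<^sub>R v) = q"
    by simp
  have "f ((1 - ?t) *\<^sub>R (q + h *\<^sub>R v) + ?t *\<^sub>R (q - \<delta> *\<^sub>R v))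
      \<le> (1 - ?t) * f (q + h *\<^sub>R v) + ?t * f (q - \<delta> *\<^sub>R v)"
    by (rule convex_onD[OF f]) (use assms in auto)
  hence "f q \<le> (\<delta> * f (q + h *\<^sub>R v) + h * f (q - \<delta> *\<^sub>R v)) / (\<delta> + h)"
    unfolding q unfolding t by (simp add: add_divide_distrib)
  hence "f q * (\<delta> + h) \<le> \<delta> * f (q + h *\<^sub>R v) + h * f (q - \<delta> *\<^sub>R v)"
    using assms by (simp add: pos_le_divide_eq)
  thus ?thesis using assms by (simp add: field_simps)
qed

text \<open>Forward quotients decrease as the step shrinks and stay above a fixed backward quotient,
  so they converge to their infimum over steps in \<open>(0, 1]\<close>.\<close>

lemma convex_on_one_sided_derivative:
  fixes f :: "'v::real_vector \<Rightarrow> real"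
  assumes f: "convex_on D f" and D: "q \<in> D" "q + v \<in> D" "q - \<delta> *\<^sub>R v \<in> D" and \<delta>: "0 < \<delta>"
  obtains r where "((\<lambda>h. (f (q + h *\<^sub>R v) - f q) / h) \<longlongrightarrow> r) (at_right 0)"
proof -
  define s where "s h = (f (q + h *\<^sub>R v) - f q) / h" for h
  define L where "L = (f q - f (q - \<delta> *\<^sub>R v)) / \<delta>"
  have cD: "convex D" using f by (simp add: convex_on_def)
  have inD: "q + h *\<^sub>R v \<in> D" if "0 < h" "h \<le> 1" for h
  proof -
    have "(1 - h) *\<^sub>R q + h *\<^sub>R (q + v) \<in> D"
      using cD that D by (simp add: convex_alt)
    thus ?thesis by (simp add: algebra_simps)
  qed
  have mono: "s h \<le> s k" if "0 < h" "h \<le> k" "k \<le> 1" for h k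
    unfolding s_def
    by (rule convex_on_difference_quotient_mono[OF f D(1)]) (use that inD in auto)
  have low: "L \<le> s h" if "0 < h" "h \<le> 1" for h
    unfolding s_def L_def
    by (rule convex_on_difference_quotient_lower[OF f]) (use that inD D \<delta> in auto)
  define r where "r = (INF h\<in>{0<..1}. s h)"
  have bdd: "bdd_below (s ` {0<..1})"
    using low by (intro bdd_belowI2[of _ L]) auto
  have "(s \<longlongrightarrow> r) (at_right 0)"
  proof (rule order_tendstoI)
    fix a assume a: "a < r"
    have "a < s h" if "h \<in> {0<..<1}" for h
      using cINF_lower[OF bdd, of h] that a unfolding r_def by simp
    thus "\<forall>\<^sub>F h in at_right 0. a < s h"
      by (intro eventually_at_rightI[of 0 1]) auto
  next
    fix a assume "r < a"
    then obtain k where k: "k \<in> {0<..1}" "s k < a"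
      unfolding r_def using cINF_less_iff[OF _ bdd, of a] by auto
    have "s h < a" if "h \<in> {0<..<k}" for h
      using mono[of h k] that k by auto
    thus "\<forall>\<^sub>F h in at_right 0. s h < a"
      using k by (intro eventually_at_rightI[of 0 k]) auto
  qed
  thus ?thesis using that unfolding s_def by blast
qed

section \<open>Gradients and Bregman divergences as limits of difference quotients\<close>

lemma gradient_eq:
  assumes "has_gradient F q g"
  shows "gradient F q = g"
proof -
  have "g' = g" if "has_gradient F q g'" for g'
  proof -
    have "(\<lambda>h. h \<bullet> g') = (\<lambda>h. h \<bullet> g)"
      using assms that unfolding has_gradient_def gderiv_def
      by (blast intro: has_derivative_unique)
    \<comment> \<open>The two derivatives agree as linear maps; evaluating them at
      \<open>g' - g\<close> gives a vanishing squared norm.\<close>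
    hence "(g' - g) \<bullet> g' = (g' - g) \<bullet> g" by meson
    thus ?thesis by (metis inner_diff_right inner_eq_zero_iff right_minus_eq)
  qed
  thus ?thesis unfolding gradient_def using assms by (blast intro: the_equality)
qed

lemma has_gradient_directional:
  assumes "has_gradient F q g"
  shows "((\<lambda>h. (real_of_ereal (F (q + h *\<^sub>R v)) - real_of_ereal (F q)) / h) \<longlongrightarrow> g \<bullet> v) (at_right 0)"
proof -
  have "((\<lambda>y. real_of_ereal (F y)) has_derivative (\<lambda>h. h \<bullet> g)) (at (q + 0 *\<^sub>R v))"
    using assms by (simp add: has_gradient_def gderiv_def)
  moreover have "((\<lambda>h::real. q + h *\<^sub>R v) has_derivative (\<lambda>h. h *\<^sub>R v)) (at 0)"
    by (auto intro!: derivative_eq_intros)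
  ultimately have "((\<lambda>h::real. real_of_ereal (F (q + h *\<^sub>R v))) has_derivative (\<lambda>h. (h *\<^sub>R v) \<bullet> g)) (at 0)"
    by (rule has_derivative_compose[rotated])
  hence "DERIV (\<lambda>h::real. real_of_ereal (F (q + h *\<^sub>R v))) 0 :> g \<bullet> v"
    by (simp add: has_field_derivative_def inner_commute mult_commute_abs)
  hence "((\<lambda>h. (real_of_ereal (F (q + h *\<^sub>R v)) - real_of_ereal (F q)) / h) \<longlongrightarrow> g \<bullet> v) (at 0)"
    by (simp add: DERIV_def)
  thus ?thesis by (rule filterlim_mono) (auto intro: at_le)
qed

text \<open>Both branches of \<open>bregman\<close>, the gradient and the directional derivative,
  are limits of the same real difference quotients, so later arguments need no case distinction. The
  point of \<open>D\<close> on the far side of \<open>q\<close> makes the directional derivative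
  finite.\<close>

lemma bregman_eq_limit:
  fixes F :: "'v::real_inner \<Rightarrow> ereal"
  defines "f \<equiv> \<lambda>x. real_of_ereal (F x)"
  assumes F: "proper_fun F" "convex_fun F" and D: "convex D" "D \<subseteq> edom F"
    and pq: "p \<in> D" "q \<in> D" "q - \<delta> *\<^sub>R (p - q) \<in> D" "0 < \<delta>"
  obtains r where "((\<lambda>h. (f (q + h *\<^sub>R (p - q)) - f q) / h) \<longlongrightarrow> r) (at_right 0)"
    and "real_of_ereal (bregman F p q) = f p - f q - r"
proof -
  have fin: "F z = ereal (f z)" if "z \<in> D" for z
    using edom_finite[OF F(1)] that D(2) unfolding f_def by blast
  show ?thesis
  proof (cases "\<exists>g. has_gradient F q g")
    case True
    then obtain g where g: "has_gradient F q g" by blast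
    have "bregman F p q = ereal (f p - f q - g \<bullet> (p - q))"
      using True fin[OF pq(1)] fin[OF pq(2)] by (simp add: bregman_def gradient_eq[OF g])
    thus ?thesis using that has_gradient_directional[OF g, of "p - q"] unfolding f_def by simp
  next
    case False
    have f: "convex_on D f"
      unfolding f_def by (rule convex_fun_imp_convex_on) fact+
    obtain r where r: "((\<lambda>h. (f (q + h *\<^sub>R (p - q)) - f q) / h) \<longlongrightarrow> r) (at_right 0)"
      by (rule convex_on_one_sided_derivative[OF f, of q "p - q" \<delta>]) (use pq in auto)
    have inD: "q + h *\<^sub>R (p - q) \<in> D" if "0 < h" "h < 1" for h
    proof -
      have "(1 - h) *\<^sub>R q + h *\<^sub>R p \<in> D"
        using D(1) that pq by (simp add: convex_alt)
      thus ?thesis by (simp add: algebra_simps)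
    qed
    have "((\<lambda>h. (F (q + h *\<^sub>R (p - q)) - F q) / ereal h) \<longlongrightarrow> ereal r) (at_right 0)"
    proof (rule Lim_transform_eventually)
      show "((\<lambda>h. ereal ((f (q + h *\<^sub>R (p - q)) - f q) / h)) \<longlongrightarrow> ereal r) (at_right 0)"
        using r by simp
      \<comment> \<open>For steps below 1 the points stay in \<open>D\<close>, where
        \<open>F\<close> is finite and equals \<open>f\<close>; this is enough for a limit at
        0.\<close>
      show "\<forall>\<^sub>F h in at_right 0. ereal ((f (q + h *\<^sub>R (p - q)) - f q) / h)
          = (F (q + h *\<^sub>R (p - q)) - F q) / ereal h"
        using inD pq fin by (intro eventually_at_rightI[of 0 1]) auto
    qed
    hence "dir_deriv F q (p - q) = ereal r"
      unfolding dir_deriv_def by (intro tendsto_Lim) auto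
    hence "bregman F p q = ereal (f p - f q - r)"
      using fin pq unfolding bregman_def if_not_P[OF False] by simp
    thus ?thesis using that r by simp
  qed
qed

lemma sum_pmf_scaleR_in_convex:
  assumes "finite (set_pmf Q)" "convex D" "\<And>w. w \<in> set_pmf Q \<Longrightarrow> X w \<in> D"
  shows "(\<Sum>w\<in>set_pmf Q. pmf Q w *\<^sub>R X w) \<in> D"
  by (rule convex_sum) (use assms in \<open>auto simp: sum_pmf_eq_1\<close>)

lemma expectation_finite:
  fixes X :: "'w \<Rightarrow> 'v::{banach, second_countable_topology}"
  assumes "finite (set_pmf Q)"
  shows "measure_pmf.expectation Q X = (\<Sum>w\<in>set_pmf Q. pmf Q w *\<^sub>R X w)"
  by (rule integral_measure_pmf) (use assms in auto)

lemma expectation_in_convex: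
  fixes X :: "'w \<Rightarrow> 'v::{banach, second_countable_topology}"
  assumes "finite (set_pmf Q)" "convex D" "\<And>w. w \<in> set_pmf Q \<Longrightarrow> X w \<in> D"
  shows "measure_pmf.expectation Q X \<in> D"
  using sum_pmf_scaleR_in_convex[OF assms] by (simp add: expectation_finite assms)

text \<open>The one-sided derivatives in the Bregman divergences are limits of difference quotients whose
  weighted sums are nonnegative by Jensen's inequality.\<close>

lemma expected_bregman:
  fixes F :: "'v::euclidean_space \<Rightarrow> ereal" and X :: "'w \<Rightarrow> 'v"
  defines "f \<equiv> \<lambda>x. real_of_ereal (F x)"
  assumes F: "proper_fun F" "convex_fun F" and D: "convex D" "D \<subseteq> edom F"
    and Q: "finite (set_pmf Q)" and X: "\<And>w. w \<in> set_pmf Q \<Longrightarrow> X w \<in> D"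
    and q: "q = measure_pmf.expectation Q X"
  shows "measure_pmf.expectation Q (\<lambda>w. real_of_ereal (bregman F (X w) q))
      \<le> measure_pmf.expectation Q (\<lambda>w. f (X w)) - f q" (is ?le)
    and "0 \<le> measure_pmf.expectation Q (\<lambda>w. real_of_ereal (bregman F (X w) q))" (is ?ge)
proof -
  let ?S = "set_pmf Q"
  have f: "convex_on D f"
    unfolding f_def by (rule convex_fun_imp_convex_on) fact+
  have qs: "q = (\<Sum>w\<in>?S. pmf Q w *\<^sub>R X w)"
    unfolding q by (rule expectation_finite[OF Q])
  have one: "(\<Sum>w\<in>?S. pmf Q w) = 1" by (rule sum_pmf_eq_1[OF Q]) simp
  have qD: "q \<in> D" unfolding qs by (rule sum_pmf_scaleR_in_convex[OF Q D(1) X])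
  \<comment> \<open>Moving from \<open>q\<close> away from \<open>X w\<close> stays in
    \<open>D\<close> for a short while, because \<open>X w\<close> has positive weight in the mean
    \<open>q\<close>. The coefficients \<open>?c\<close> sum to 1, and at \<open>w\<close> itself
    the coefficient is the square of \<open>pmf Q w\<close>.\<close>
  have refl_pt: "q - pmf Q w *\<^sub>R (X w - q) \<in> D" if w: "w \<in> ?S" for w
  proof -
    let ?c = "\<lambda>w'. (1 + pmf Q w) * pmf Q w' - (if w' = w then pmf Q w else 0)"
    have "(\<Sum>w'\<in>?S. ?c w' *\<^sub>R X w') \<in> D"
    proof (rule convex_sum[OF Q D(1)])
      show "sum ?c ?S = 1"
        using w Q one by (simp add: sum_subtractf sum.delta flip: sum_distrib_left)
      show "0 \<le> ?c w'" for w' by (auto simp: algebra_simps)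
    qed (rule X)
    also have "(\<Sum>w'\<in>?S. ?c w' *\<^sub>R X w')
        = (1 + pmf Q w) *\<^sub>R q - (\<Sum>w'\<in>?S. if w' = w then pmf Q w *\<^sub>R X w else 0)"
      unfolding qs scaleR_sum_right sum_subtractf[symmetric]
      by (rule sum.cong) (auto simp: scaleR_diff_left)
    also have "\<dots> = q - pmf Q w *\<^sub>R (X w - q)"
      using w Q by (simp add: sum.delta algebra_simps)
    finally show ?thesis .
  qed
  have "\<exists>r. ((\<lambda>h. (f (q + h *\<^sub>R (X w - q)) - f q) / h) \<longlongrightarrow> r) (at_right 0)
      \<and> real_of_ereal (bregman F (X w) q) = f (X w) - f q - r" if w: "w \<in> ?S" for w
    by (rule bregman_eq_limit[OF F D X[OF w] qD refl_pt[OF w]])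
       (use w in \<open>auto simp: f_def pmf_positive\<close>)
  hence "\<forall>w\<in>?S. \<exists>r. ((\<lambda>h. (f (q + h *\<^sub>R (X w - q)) - f q) / h) \<longlongrightarrow> r) (at_right 0)
      \<and> real_of_ereal (bregman F (X w) q) = f (X w) - f q - r"
    by blast
  from bchoice[OF this] obtain r where r: "\<And>w. w \<in> ?S \<Longrightarrow>
        ((\<lambda>h. (f (q + h *\<^sub>R (X w - q)) - f q) / h) \<longlongrightarrow> r w) (at_right 0)"
      "\<And>w. w \<in> ?S \<Longrightarrow> real_of_ereal (bregman F (X w) q) = f (X w) - f q - r w"
    by blast
  have inD: "q + h *\<^sub>R (X w - q) \<in> D" if "w \<in> ?S" "0 < h" "h < 1" for w h
  proof -
    have "(1 - h) *\<^sub>R q + h *\<^sub>R X w \<in> D"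
      using D(1) that qD X by (simp add: convex_alt)
    thus ?thesis by (simp add: algebra_simps)
  qed
  have "0 \<le> (\<Sum>w\<in>?S. pmf Q w * r w)"
  proof (rule tendsto_lowerbound)
    show "((\<lambda>h. \<Sum>w\<in>?S. pmf Q w * ((f (q + h *\<^sub>R (X w - q)) - f q) / h))
        \<longlongrightarrow> (\<Sum>w\<in>?S. pmf Q w * r w)) (at_right 0)"
      by (intro tendsto_intros r)
    have "0 \<le> (\<Sum>w\<in>?S. pmf Q w * ((f (q + h *\<^sub>R (X w - q)) - f q) / h))" if h: "0 < h" "h < 1" for h
    proof -
      \<comment> \<open>The points shrunk towards \<open>q\<close> still have mean \<open>q\<close>,
        so Jensen's inequality can be applied at each step size \<open>h\<close>.\<close>
      have "(\<Sum>w\<in>?S. pmf Q w *\<^sub>R (q + h *\<^sub>R (X w - q)))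
          = (\<Sum>w\<in>?S. pmf Q w *\<^sub>R ((1 - h) *\<^sub>R q) + h *\<^sub>R (pmf Q w *\<^sub>R X w))"
        by (rule sum.cong) (auto simp: algebra_simps)
      also have "\<dots> = q"
        unfolding sum.distrib scaleR_sum_left[symmetric] scaleR_sum_right[symmetric] one qs[symmetric]
        by (simp add: algebra_simps)
      finally have eq: "(\<Sum>w\<in>?S. pmf Q w *\<^sub>R (q + h *\<^sub>R (X w - q))) = q" .
      have "f (\<Sum>w\<in>?S. pmf Q w *\<^sub>R (q + h *\<^sub>R (X w - q)))
          \<le> (\<Sum>w\<in>?S. pmf Q w * f (q + h *\<^sub>R (X w - q)))"
        by (rule convex_on_sum[OF Q _ f one]) (use inD h set_pmf_not_empty in auto)
      hence "f q * (\<Sum>w\<in>?S. pmf Q w) \<le> (\<Sum>w\<in>?S. pmf Q w * f (q + h *\<^sub>R (X w - q)))"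
        unfolding eq one by simp
      hence "0 \<le> (\<Sum>w\<in>?S. pmf Q w * (f (q + h *\<^sub>R (X w - q)) - f q)) / h"
        using h by (simp add: right_diff_distrib sum_subtractf sum_distrib_left mult.commute)
      thus ?thesis by (simp add: sum_divide_distrib)
    qed
    thus "\<forall>\<^sub>F h in at_right 0. 0 \<le> (\<Sum>w\<in>?S. pmf Q w * ((f (q + h *\<^sub>R (X w - q)) - f q) / h))"
      by (intro eventually_at_rightI[of 0 1]) auto
  qed simp
  moreover have "measure_pmf.expectation Q (\<lambda>w. real_of_ereal (bregman F (X w) q))
      = (\<Sum>w\<in>?S. pmf Q w * (f (X w) - f q - r w))"
    unfolding expectation_finite[OF Q] by (rule sum.cong) (auto simp: r(2))
  moreover have "(\<Sum>w\<in>?S. pmf Q w * (f (X w) - f q - r w))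
      = (\<Sum>w\<in>?S. pmf Q w * f (X w)) - (\<Sum>w\<in>?S. pmf Q w) * f q - (\<Sum>w\<in>?S. pmf Q w * r w)"
    by (simp add: right_diff_distrib sum_subtractf sum_distrib_right)
  moreover have "measure_pmf.expectation Q (\<lambda>w. f (X w)) = (\<Sum>w\<in>?S. pmf Q w * f (X w))"
    unfolding expectation_finite[OF Q] by simp
  ultimately show ?le using one by simp
  \<comment> \<open>Nonnegativity holds term by term: the limit of the quotients is at most the
    quotient with step 1.\<close>
  have "0 \<le> f (X w) - f q - r w" if w: "w \<in> ?S" for w
  proof -
    have "(f (q + h *\<^sub>R (X w - q)) - f q) / h \<le> f (X w) - f q" if h: "0 < h" "h < 1" for h
      using convex_on_difference_quotient_mono[OF f qD, of 1 "X w - q" h] h X[OF w] by simp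
    hence "r w \<le> f (X w) - f q"
      by (intro tendsto_upperbound[OF r(1)[OF w]] eventually_at_rightI[of 0 1]) auto
    thus ?thesis by simp
  qed
  thus ?ge unfolding expectation_finite[OF Q] by (intro sum_nonneg) (auto simp: r(2))
qed

subsection \<open>Minimisers of the information ratio\<close>

text \<open>Here \<open>G\<close> and \<open>J\<close> are the gap and information of the minimiser,
  \<open>g\<close> and \<open>i\<close> those of a competitor. Optimality along the segment between
  them gives \<open>G \<le> 2 g\<close>. Writing \<open>G^l / J\<close> as \<open>G^(l-2)\<close>
  times the ratio \<open>G^2 / J\<close>, the first factor is bounded by \<open>(2 g)^(l-2)\<close>,
  where \<open>l \<ge> 2\<close> is used, and the second by the ratio of the competitor.\<close>

lemma arg_min_ratio_bound:
  fixes G J g i l \<beta> :: real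
  assumes pos: "0 < G" "0 < J" "0 < g" "0 < i" and l: "2 \<le> l" and "0 \<le> \<beta>"
    and ratio: "G\<^sup>2 / J \<le> g\<^sup>2 / i"
    and mix: "\<And>e. 0 < e \<Longrightarrow> e < 1 \<Longrightarrow>
      G\<^sup>2 / J \<le> ((1 - e) * G + e * g)\<^sup>2 / ((1 - e) * J + e * i)"
    and info: "g \<le> \<beta> powr (1 - 1 / l) * i powr (1 / l)"
  shows "G \<le> 2 powr (1 - 2 / l) * \<beta> powr (1 - 1 / l) * J powr (1 / l)"
proof -
  \<comment> \<open>Clearing denominators in \<open>mix\<close> cancels the terms of order zero in
    \<open>e\<close>; dividing by \<open>e\<close> leaves the first-order condition with an error
    linear in \<open>e\<close>.\<close>
  have "G\<^sup>2 * (i - J) \<le> J * (2 * G * (g - G) + e * (g - G)\<^sup>2)" if e: "0 < e" "e < 1" for e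
  proof -
    have "0 < (1 - e) * J + e * i" using e pos by (simp add: add_pos_pos)
    hence "G\<^sup>2 * ((1 - e) * J + e * i) \<le> ((1 - e) * G + e * g)\<^sup>2 * J"
      using mix[OF e] pos by (simp add: pos_divide_le_eq) (simp add: pos_le_divide_eq)
    moreover have "((1 - e) * G + e * g)\<^sup>2 * J - G\<^sup>2 * ((1 - e) * J + e * i)
        = e * (J * (2 * G * (g - G) + e * (g - G)\<^sup>2) - G\<^sup>2 * (i - J))"
      by algebra
    ultimately have "0 \<le> e * (J * (2 * G * (g - G) + e * (g - G)\<^sup>2) - G\<^sup>2 * (i - J))"
      by linarith
    thus ?thesis using e by (simp add: zero_le_mult_iff)
  qed
  hence "\<forall>\<^sub>F e in at_right 0. G\<^sup>2 * (i - J) \<le> J * (2 * G * (g - G) + e * (g - G)\<^sup>2)"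
    by (intro eventually_at_rightI[of 0 1]) auto
  moreover have "((\<lambda>e. J * (2 * G * (g - G) + e * (g - G)\<^sup>2))
      \<longlongrightarrow> J * (2 * G * (g - G) + 0 * (g - G)\<^sup>2)) (at_right 0)"
    by (intro tendsto_intros)
  ultimately have "G\<^sup>2 * (i - J) \<le> J * (2 * G * (g - G) + 0 * (g - G)\<^sup>2)"
    by (intro tendsto_lowerbound) auto
  moreover have "J * (2 * G * (g - G) + 0 * (g - G)\<^sup>2) - G\<^sup>2 * (i - J)
      = G * (2 * J * g - G * (i + J))"
    by algebra
  ultimately have "0 \<le> G * (2 * J * g - G * (i + J))" by linarith
  hence "G * (i + J) \<le> 2 * J * g" using pos by (simp add: zero_le_mult_iff)
  \<comment> \<open>Discarding the positive term \<open>G * i\<close> loses nothing essential and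
    lets \<open>J\<close> cancel.\<close>
  moreover have "G * J \<le> G * (i + J)" using pos by simp
  ultimately have "G * J \<le> (2 * g) * J" by (simp add: mult.commute mult.left_commute)
  hence Gg: "G \<le> 2 * g" using pos by simp
  have l0: "0 < l" using l by simp
  have gl: "g powr l \<le> \<beta> powr (l - 1) * i"
  proof -
    have "g powr l \<le> (\<beta> powr (1 - 1 / l) * i powr (1 / l)) powr l"
      using info pos l by (intro powr_mono2) auto
    also have "\<dots> = \<beta> powr (l - 1) * i"
      using l pos by (simp add: powr_mult powr_powr algebra_simps)
    finally show ?thesis .
  qed
  have sq: "x powr l = x powr (l - 2) * x\<^sup>2" if "0 < x" for x :: real
    using that by (simp add: powr_diff)
  have "G powr l / J = G powr (l - 2) * (G\<^sup>2 / J)"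
    using sq[OF pos(1)] by simp
  also have "\<dots> \<le> (2 * g) powr (l - 2) * (g\<^sup>2 / i)"
    using Gg pos l ratio by (intro mult_mono powr_mono2) auto
  also have "\<dots> = 2 powr (l - 2) * (g powr l / i)"
    using sq[OF pos(3)] pos by (simp add: powr_mult)
  also have "\<dots> \<le> 2 powr (l - 2) * \<beta> powr (l - 1)"
    using gl pos by (simp add: field_simps)
  finally have "G powr l \<le> 2 powr (l - 2) * \<beta> powr (l - 1) * J"
    using pos by (simp add: field_simps)
  hence "(G powr l) powr (1 / l) \<le> (2 powr (l - 2) * \<beta> powr (l - 1) * J) powr (1 / l)"
    using l0 by (intro powr_mono2) auto
  thus ?thesis using l0 pos by (simp add: powr_mult powr_powr diff_divide_distrib)
qed

section \<open>The sampling objective along segments of distributions\<close>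

definition mix_pmf :: "real \<Rightarrow> 'a pmf \<Rightarrow> 'a pmf \<Rightarrow> 'a pmf" where
  "mix_pmf e p q = bind_pmf (bernoulli_pmf e) (\<lambda>b. if b then q else p)"

lemma pmf_mix_pmf:
  assumes "0 \<le> e" "e \<le> 1"
  shows "pmf (mix_pmf e p q) x = (1 - e) * pmf p x + e * pmf q x"
  unfolding mix_pmf_def pmf_bind using assms by (simp add: integral_measure_pmf[of UNIV] UNIV_bool)

lemma set_mix_pmf: "set_pmf (mix_pmf e p q) \<subseteq> set_pmf p \<union> set_pmf q"
  unfolding mix_pmf_def by (auto split: if_splits)

text \<open>The regularisation resolves the degenerate quotients: a nonpositive gap gives 0 even
  without information, while a positive gap without information gives infinity.\<close>

lemma ids_objective_eq:
  fixes A :: "'v set" and p :: "'v pmf"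
  defines "G \<equiv> \<lambda>\<Delta> p. \<Sum>a\<in>A. pmf p a * \<Delta> a"
  assumes "0 \<le> G I p"
  shows "ids_objective A \<Delta> I p =
    (if G \<Delta> p \<le> 0 then 0 else if G I p = 0 then \<infinity> else ereal ((G \<Delta> p)\<^sup>2 / G I p))"
proof -
  let ?g = "G \<Delta> p" and ?i = "G I p"
  let ?h = "\<lambda>\<epsilon>::real. ereal ((max 0 ?g)\<^sup>2 / (?i + \<epsilon>))"
  have L: "ids_objective A \<Delta> I p = L" if "(?h \<longlongrightarrow> L) (at_right 0)" for L
    unfolding ids_objective_def using that unfolding G_def by (intro tendsto_Lim) auto
  consider "?g \<le> 0" | "?g > 0" "?i = 0" | "?g > 0" "?i > 0"
    using assms(2) by fastforce
  thus ?thesis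
  proof cases
    case 1
    thus ?thesis by (intro L) (simp add: zero_ereal_def)
  next
    case 2
    have "LIM \<epsilon> at_right 0. (?g)\<^sup>2 * inverse \<epsilon> :> at_top"
      by (rule filterlim_tendsto_pos_mult_at_top[OF tendsto_const _ filterlim_inverse_at_top_right])
         (use 2 in simp)
    hence "(?h \<longlongrightarrow> \<infinity>) (at_right 0)"
      using 2 by (simp add: tendsto_PInfty_eq_at_top divide_inverse)
    thus ?thesis using 2 by (simp add: L)
  next
    case 3
    have "((\<lambda>\<epsilon>. ?g\<^sup>2 / (?i + \<epsilon>)) \<longlongrightarrow> ?g\<^sup>2 / (?i + 0)) (at_right 0)"
      by (intro tendsto_intros) (use 3 in auto)
    hence "(?h \<longlongrightarrow> ereal (?g\<^sup>2 / ?i)) (at_right 0)"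
      using 3 by simp
    thus ?thesis using 3 by (simp add: L)
  qed
qed

text \<open>A nonpositive gap makes the claim trivial. Otherwise the objective at \<open>p\<close>
  is positive, and minimality then forces all four quantities in \<open>arg_min_ratio_bound\<close>
  to be positive.\<close>

lemma ids_gap_bound:
  fixes A :: "'v set" and \<Delta> I :: "'v \<Rightarrow> real" and p :: "'v pmf"
  defines "G \<equiv> \<lambda>\<Delta> p. \<Sum>a\<in>A. pmf p a * \<Delta> a"
  assumes opt: "is_arg_min (ids_objective A \<Delta> I) (\<lambda>p. set_pmf p \<subseteq> A) p"
    and I: "\<And>a. a \<in> A \<Longrightarrow> 0 \<le> I a" and l: "2 \<le> l" and \<beta>: "0 \<le> \<beta>"
    and q: "set_pmf q \<subseteq> A" and info: "G \<Delta> q \<le> \<beta> powr (1 - 1 / l) * G I q powr (1 / l)"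
  shows "G \<Delta> p \<le> 2 powr (1 - 2 / l) * \<beta> powr (1 - 1 / l) * G I p powr (1 / l)"
proof (cases "G \<Delta> p \<le> 0")
  case True
  thus ?thesis by (meson order_trans mult_nonneg_nonneg powr_ge_zero)
next
  case False
  let ?O = "ids_objective A \<Delta> I"
  have I0: "0 \<le> G I r" for r
    unfolding G_def by (intro sum_nonneg mult_nonneg_nonneg I) auto
  have O: "?O r = (if G \<Delta> r \<le> 0 then 0 else if G I r = 0 then \<infinity> else ereal ((G \<Delta> r)\<^sup>2 / G I r))" for r
    using I0[of r] ids_objective_eq[where A = A and I = I and p = r and \<Delta> = \<Delta>] unfolding G_def by simp
  have min: "?O p \<le> ?O r" if "set_pmf r \<subseteq> A" for r
    using opt that unfolding is_arg_min_def by (meson not_le)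
  have pA: "set_pmf p \<subseteq> A" using opt by (simp add: is_arg_min_def)
  have Opos: "0 < ?O p"
    using False I0[of p] by (auto simp: O less_le)
  \<comment> \<open>A nonpositive gap of \<open>q\<close> would give it objective 0, below that of
    \<open>p\<close>.\<close>
  have gq: "0 < G \<Delta> q"
    using Opos min[OF q] O[of q] by (metis leD not_le_imp_less)
  \<comment> \<open>Since \<open>0 powr (1 / l) = 0\<close>, zero information would force the gap of
    \<open>q\<close> to be at most 0.\<close>
  have iq: "0 < G I q"
    using gq info I0[of q] by (cases "G I q = 0") auto
  have Oq: "?O q = ereal ((G \<Delta> q)\<^sup>2 / G I q)"
    using gq iq by (simp add: O)
  \<comment> \<open>With zero information the objective at \<open>p\<close> would be infinite, but
    it is at most the finite objective at \<open>q\<close>.\<close>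
  have ip: "0 < G I p"
    using min[OF q] Oq O[of p] False I0[of p] by (cases "G I p = 0") auto
  have Op: "?O p = ereal ((G \<Delta> p)\<^sup>2 / G I p)"
    using False ip by (simp add: O)
  show ?thesis
  proof (rule arg_min_ratio_bound[OF _ ip gq iq l \<beta> _ _ info])
    show "0 < G \<Delta> p" using False by simp
    show "(G \<Delta> p)\<^sup>2 / G I p \<le> (G \<Delta> q)\<^sup>2 / G I q"
      using min[OF q] Oq Op by simp
    fix e :: real assume e: "0 < e" "e < 1"
    let ?r = "mix_pmf e p q"
    \<comment> \<open>Gap and information are both linear in the distribution, so mixing the
      distributions yields exactly the quotient in the hypothesis \<open>mix\<close>.\<close>
    have lin: "G X ?r = (1 - e) * G X p + e * G X q" for X
      unfolding G_def using e
      by (simp add: pmf_mix_pmf sum_distrib_left sum.distrib distrib_right mult.assoc)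
    have pos: "0 < G \<Delta> ?r" "0 < G I ?r"
      unfolding lin using e False gq iq ip by (auto intro!: add_pos_pos)
    have "?O p \<le> ?O ?r"
      using min[of ?r] set_mix_pmf[of e p q] pA q by blast
    thus "(G \<Delta> p)\<^sup>2 / G I p \<le>
        ((1 - e) * G \<Delta> p + e * G \<Delta> q)\<^sup>2 / ((1 - e) * G I p + e * G I q)"
      using pos O[of ?r] Op lin by simp
  qed
qed

section \<open>Concavity of powers and summation over rounds\<close>

lemma powr_tangent_bound:
  fixes a s x :: real
  assumes "0 < a" "a \<le> 1" "0 < s" "0 \<le> x"
  shows "x powr a \<le> s powr a + a * s powr (a - 1) * (x - s)"
proof (cases "x = 0")
  case True
  have "s powr (a - 1) * s = s powr a" using assms by (simp add: powr_diff)
  hence "s powr a + a * s powr (a - 1) * (x - s) = (1 - a) * s powr a"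
    using True by (simp add: algebra_simps)
  thus ?thesis using True assms by simp
next
  case False
  \<comment> \<open>The tangent at \<open>s\<close> is Young's inequality for \<open>x / s\<close>
    and 1, rescaled by \<open>s powr a\<close>.\<close>
  have "(x / s) powr a * 1 powr (1 - a) \<le> a * (x / s) + (1 - a) * 1"
    by (rule Youngs_inequality_0) (use assms False in auto)
  hence "x powr a / s powr a \<le> a * (x / s) + (1 - a)"
    using assms by (simp add: powr_divide)
  hence "x powr a \<le> (a * (x / s) + (1 - a)) * s powr a"
    using assms by (simp add: pos_divide_le_eq)
  also have "\<dots> = s powr a + a * (s powr a / s) * (x - s)"
  proof -
    have "(a * (x / s) + (1 - a)) * P = P + a * (P / s) * (x - s)" for P :: real
      using assms by (simp add: field_simps)
    thus ?thesis .
  qed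
  also have "s powr a / s = s powr (a - 1)"
    using assms by (simp add: powr_diff)
  finally show ?thesis .
qed

text \<open>A single tangent line, at a point \<open>s\<close> common to all rounds, is linear and
  so passes through the sum and the expectations. This handles Jensen's inequality within rounds and
  across rounds at once.\<close>

lemma sum_expectation_powr_le:
  fixes J :: "nat \<Rightarrow> 'h \<Rightarrow> real" and H :: "nat \<Rightarrow> 'h pmf"
  assumes n: "0 < n" and a: "0 < a" "a \<le> 1"
    and fin: "\<And>t. t < n \<Longrightarrow> finite (set_pmf (H t))"
    and J: "\<And>t h. t < n \<Longrightarrow> h \<in> set_pmf (H t) \<Longrightarrow> 0 \<le> J t h"
    and S: "(\<Sum>t<n. measure_pmf.expectation (H t) (J t)) \<le> S"
  shows "(\<Sum>t<n. measure_pmf.expectation (H t) (\<lambda>h. J t h powr a)) \<le> real n powr (1 - a) * S powr a"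
proof -
  let ?E = "\<lambda>t. measure_pmf.expectation (H t)"
  have int: "integrable (H t) (X :: 'h \<Rightarrow> real)" if "t < n" for t X
    by (rule integrable_measure_pmf_finite[OF fin[OF that]])
  have main: "(\<Sum>t<n. ?E t (\<lambda>h. J t h powr a)) \<le> n * s powr a" if s: "0 < s" "S \<le> n * s" for s :: real
  proof -
    have "(\<Sum>t<n. ?E t (\<lambda>h. J t h powr a))
        \<le> (\<Sum>t<n. ?E t (\<lambda>h. s powr a + a * s powr (a - 1) * (J t h - s)))"
      using a s J by (intro sum_mono integral_mono_AE int)
        (auto simp: AE_measure_pmf_iff intro!: powr_tangent_bound)
    also have "\<dots> = (\<Sum>t<n. s powr a + a * s powr (a - 1) * (?E t (J t) - s))"
      by (intro sum.cong refl) (simp add: int integral_add integral_diff)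
    also have "\<dots> = n * s powr a + a * s powr (a - 1) * ((\<Sum>t<n. ?E t (J t)) - n * s)"
      by (simp add: sum.distrib sum_subtractf flip: sum_distrib_left)
    also have "\<dots> \<le> n * s powr a + a * s powr (a - 1) * 0"
      using S s a by (intro add_left_mono mult_left_mono mult_nonneg_nonneg) auto
    finally show ?thesis by simp
  qed
  have S0: "0 \<le> S"
  proof -
    have "0 \<le> ?E t (J t)" if "t < n" for t
      by (rule integral_nonneg_AE) (use J that in \<open>auto simp: AE_measure_pmf_iff\<close>)
    hence "0 \<le> (\<Sum>t<n. ?E t (J t))" by (intro sum_nonneg) auto
    thus ?thesis using S by simp
  qed
  show ?thesis
  proof (cases "S = 0")
    case False
    have "n * (S / n) powr a = real n powr (1 - a) * S powr a"
      using n S0 by (simp add: powr_divide powr_diff)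
    moreover have "0 < S / n" using n S0 False by simp
    ultimately show ?thesis using main[of "S / n"] n by simp
  next
    case True
    let ?X = "\<Sum>t<n. ?E t (\<lambda>h. J t h powr a)"
    have "?X \<le> 0"
    proof (rule ccontr)
      assume "\<not> ?X \<le> 0"
      hence pos: "0 < ?X / (2 * n)" using n by simp
      have "?X \<le> n * ((?X / (2 * n)) powr (1 / a)) powr a"
        by (rule main) (use pos True n in auto)
      also have "\<dots> = ?X / 2" using a n \<open>\<not> ?X \<le> 0\<close> by (simp add: powr_powr not_le)
      finally show False using \<open>\<not> ?X \<le> 0\<close> by simp
    qed
    thus ?thesis using True by simp
  qed
qed

subsection \<open>Histories and posteriors\<close>

lemma expectation_cong_pmf:
  fixes X X' :: "'w \<Rightarrow> 'v::{banach, second_countable_topology}"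
  assumes "\<And>w. w \<in> set_pmf M \<Longrightarrow> X w = X' w"
  shows "measure_pmf.expectation M X = measure_pmf.expectation M X'"
  by (rule integral_cong_AE) (use assms in \<open>auto simp: AE_measure_pmf_iff\<close>)

lemma expectation_mono_pmf:
  fixes X X' :: "'w \<Rightarrow> real"
  assumes "finite (set_pmf M)" "\<And>w. w \<in> set_pmf M \<Longrightarrow> X w \<le> X' w"
  shows "measure_pmf.expectation M X \<le> measure_pmf.expectation M X'"
  by (rule integral_mono_AE) (use assms in \<open>auto simp: AE_measure_pmf_iff integrable_measure_pmf_finite\<close>)

lemma expectation_bind_finite:
  fixes X :: "'w \<Rightarrow> 'v::{banach, second_countable_topology}"
  assumes "finite (set_pmf M)" "\<And>y. y \<in> set_pmf M \<Longrightarrow> finite (set_pmf (K y))"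
  shows "measure_pmf.expectation (bind_pmf M K) X
    = measure_pmf.expectation M (\<lambda>y. measure_pmf.expectation (K y) X)"
  using pmf_expectation_bind[OF assms(1), of K M X] assms
  by (simp add: expectation_finite)

lemma bind_map_cond_pmf: "bind_pmf (map_pmf Y M) (\<lambda>y. cond_pmf M {x. Y x = y}) = M"
  by (rule bind_cond_pmf_cancel) (auto simp: vimage_def eq_commute)

lemma expectation_tower:
  fixes X :: "'w \<Rightarrow> 'v::{banach, second_countable_topology}"
  assumes fin: "finite (set_pmf M)"
  shows "measure_pmf.expectation M X
    = measure_pmf.expectation (map_pmf Y M) (\<lambda>y. measure_pmf.expectation (cond_pmf M {x. Y x = y}) X)"
proof -
  have "finite (set_pmf (cond_pmf M {x. Y x = y}))" if "y \<in> set_pmf (map_pmf Y M)" for y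
    using fin that by (subst set_cond_pmf) auto
  hence "measure_pmf.expectation (bind_pmf (map_pmf Y M) (\<lambda>y. cond_pmf M {x. Y x = y})) X
    = measure_pmf.expectation (map_pmf Y M) (\<lambda>y. measure_pmf.expectation (cond_pmf M {x. Y x = y}) X)"
    using fin by (intro expectation_bind_finite) auto
  thus ?thesis by (simp only: bind_map_cond_pmf)
qed

lemma expectation_cond_exp_pmf:
  fixes X :: "'w \<Rightarrow> 'v::{banach, second_countable_topology}"
  assumes "finite (set_pmf M)"
  shows "measure_pmf.expectation M (cond_exp_pmf M X Y) = measure_pmf.expectation M X"
  using expectation_tower[OF assms, of X Y] by (simp add: cond_exp_pmf_def[abs_def])

lemma cond_exp_pmf_in_convex:
  assumes "finite (set_pmf M)" "convex D" "\<And>w. w \<in> set_pmf M \<Longrightarrow> X w \<in> D" "w \<in> set_pmf M"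
  shows "cond_exp_pmf M X Y w \<in> D"
proof -
  have "set_pmf (cond_pmf M {w'. Y w' = Y w}) = set_pmf M \<inter> {w'. Y w' = Y w}"
    using assms(4) by (intro set_cond_pmf) auto
  thus ?thesis unfolding cond_exp_pmf_def using assms by (intro expectation_in_convex) auto
qed

text \<open>Both mass functions have total 1, so the constant is 1. Conditional laws can then be
  identified without computing their normalising constants.\<close>

lemma pmf_eqI_proportional:
  assumes "\<And>x. pmf p x = c * pmf q x"
  shows "p = q"
proof -
  have c: "0 \<le> c"
  proof -
    obtain x where "x \<in> set_pmf p" using set_pmf_not_empty by fast
    hence "0 < c * pmf q x" using assms by (metis pmf_positive)
    thus ?thesis using pmf_nonneg[of q x] by (simp add: zero_less_mult_iff)
  qed
  have "1 = (\<integral>\<^sup>+x. pmf p x \<partial>count_space UNIV)"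
    by (subst nn_integral_pmf) simp
  also have "\<dots> = (\<integral>\<^sup>+x. ennreal c * pmf q x \<partial>count_space UNIV)"
    using c by (simp add: assms ennreal_mult)
  also have "\<dots> = ennreal c * (\<integral>\<^sup>+x. pmf q x \<partial>count_space UNIV)"
    by (rule nn_integral_cmult) simp
  also have "\<dots> = ennreal c" by (subst nn_integral_pmf) simp
  finally have "c = 1" using c by simp
  thus ?thesis using assms by (intro pmf_eqI) simp
qed

section \<open>Laws of histories\<close>

lemma finite_set_history_pmf:
  assumes "finite A" "is_policy A \<pi>"
  shows "finite (set_pmf (history_pmf \<Phi> \<pi> zs t)) \<and>
    (\<forall>h\<in>set_pmf (history_pmf \<Phi> \<pi> zs t). length h = t \<and> fst ` set h \<subseteq> A)"
proof (induction t)
  case (Suc t)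
  have "set_pmf (\<pi> h) \<subseteq> A" if "h \<in> set_pmf (history_pmf \<Phi> \<pi> zs t)" for h
    using Suc assms(2) that unfolding is_policy_def by blast
  moreover from this have "finite (set_pmf (\<pi> h))" if "h \<in> set_pmf (history_pmf \<Phi> \<pi> zs t)" for h
    using assms(1) that finite_subset by blast
  ultimately show ?case using Suc by fastforce
qed simp

lemma expectation_history_Suc:
  fixes X :: "('v \<times> 's) list \<Rightarrow> real"
  assumes "finite A" "is_policy A \<pi>"
  shows "measure_pmf.expectation (history_pmf \<Phi> \<pi> zs (Suc t)) X
    = measure_pmf.expectation (history_pmf \<Phi> \<pi> zs t)
        (\<lambda>h. \<Sum>a\<in>A. pmf (\<pi> h) a * X (h @ [(a, \<Phi> a (zs ! t))]))"
proof -
  let ?H = "history_pmf \<Phi> \<pi> zs t"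
  have \<pi>A: "set_pmf (\<pi> h) \<subseteq> A" if "h \<in> set_pmf ?H" for h
    using finite_set_history_pmf[OF assms, of \<Phi> zs t] assms(2) that unfolding is_policy_def by blast
  have fin: "finite (set_pmf (\<pi> h))" if "h \<in> set_pmf ?H" for h
    using \<pi>A[OF that] assms(1) finite_subset by blast
  have "measure_pmf.expectation (history_pmf \<Phi> \<pi> zs (Suc t)) X
    = measure_pmf.expectation ?H
        (\<lambda>h. measure_pmf.expectation (map_pmf (\<lambda>a. h @ [(a, \<Phi> a (zs ! t))]) (\<pi> h)) X)"
    unfolding history_pmf.simps using finite_set_history_pmf[OF assms, of \<Phi> zs t] fin
    by (intro expectation_bind_finite) auto
  also have "\<dots> = measure_pmf.expectation ?H
        (\<lambda>h. \<Sum>a\<in>A. pmf (\<pi> h) a * X (h @ [(a, \<Phi> a (zs ! t))]))"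
  proof (rule expectation_cong_pmf)
    fix h assume "h \<in> set_pmf ?H"
    thus "measure_pmf.expectation (map_pmf (\<lambda>a. h @ [(a, \<Phi> a (zs ! t))]) (\<pi> h)) X
      = (\<Sum>a\<in>A. pmf (\<pi> h) a * X (h @ [(a, \<Phi> a (zs ! t))]))"
      using integral_measure_pmf[OF assms(1), of "\<pi> h" "\<lambda>a. X (h @ [(a, \<Phi> a (zs ! t))])"] \<pi>A
      by auto
  qed
  finally show ?thesis .
qed

text \<open>Appending a round leaves the earlier entries unchanged, and the action probabilities sum
  to 1, so each round only needs the law of the history before it.\<close>

lemma expectation_history_sum:
  fixes \<phi> :: "'v \<Rightarrow> nat \<Rightarrow> real"
  assumes "finite A" "is_policy A \<pi>"
  shows "measure_pmf.expectation (history_pmf \<Phi> \<pi> zs m) (\<lambda>h. \<Sum>t<m. \<phi> (fst (h ! t)) t)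
    = (\<Sum>t<m. measure_pmf.expectation (history_pmf \<Phi> \<pi> zs t) (\<lambda>h. \<Sum>a\<in>A. pmf (\<pi> h) a * \<phi> a t))"
proof (induction m)
  case (Suc m)
  let ?H = "history_pmf \<Phi> \<pi> zs m"
  have H: "finite (set_pmf ?H)" "\<And>h. h \<in> set_pmf ?H \<Longrightarrow> length h = m \<and> fst ` set h \<subseteq> A"
    using finite_set_history_pmf[OF assms] by blast+
  have one: "(\<Sum>a\<in>A. pmf (\<pi> h) a) = 1" if "h \<in> set_pmf ?H" for h
    using H that assms by (intro sum_pmf_eq_1) (auto simp: is_policy_def)
  have "measure_pmf.expectation (history_pmf \<Phi> \<pi> zs (Suc m)) (\<lambda>h. \<Sum>t<Suc m. \<phi> (fst (h ! t)) t)
    = measure_pmf.expectation ?H (\<lambda>h. \<Sum>a\<in>A. pmf (\<pi> h) a *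
        (\<Sum>t<Suc m. \<phi> (fst ((h @ [(a, \<Phi> a (zs ! m))]) ! t)) t))"
    by (rule expectation_history_Suc[OF assms])
  also have "\<dots> = measure_pmf.expectation ?H
      (\<lambda>h. (\<Sum>t<m. \<phi> (fst (h ! t)) t) + (\<Sum>a\<in>A. pmf (\<pi> h) a * \<phi> a m))"
  proof (rule expectation_cong_pmf)
    fix h assume h: "h \<in> set_pmf ?H"
    have "(\<Sum>t<Suc m. \<phi> (fst ((h @ [(a, \<Phi> a (zs ! m))]) ! t)) t)
        = (\<Sum>t<m. \<phi> (fst (h ! t)) t) + \<phi> a m" for a
      using H(2)[OF h] by (simp add: nth_append)
    thus "(\<Sum>a\<in>A. pmf (\<pi> h) a * (\<Sum>t<Suc m. \<phi> (fst ((h @ [(a, \<Phi> a (zs ! m))]) ! t)) t))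
        = (\<Sum>t<m. \<phi> (fst (h ! t)) t) + (\<Sum>a\<in>A. pmf (\<pi> h) a * \<phi> a m)"
      using one[OF h] by (simp add: distrib_left sum.distrib flip: sum_distrib_right)
  qed
  also have "\<dots> = measure_pmf.expectation ?H (\<lambda>h. \<Sum>t<m. \<phi> (fst (h ! t)) t)
      + measure_pmf.expectation ?H (\<lambda>h. \<Sum>a\<in>A. pmf (\<pi> h) a * \<phi> a m)"
    by (intro Bochner_Integration.integral_add integrable_measure_pmf_finite H(1))
  finally show ?case using Suc by simp
qed simp

section \<open>Joint laws of latent sequences and histories, and posteriors\<close>

lemma set_joint_pmf:
  "set_pmf (joint_pmf \<Phi> \<mu> \<pi> t) = (SIGMA zs:set_pmf \<mu>. set_pmf (history_pmf \<Phi> \<pi> zs t))"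
  by (auto simp: joint_pmf_def)

lemma finite_set_joint_pmf:
  assumes "finite A" "is_policy A \<pi>" "finite (set_pmf \<mu>)"
  shows "finite (set_pmf (joint_pmf \<Phi> \<mu> \<pi> t))"
  unfolding set_joint_pmf using assms finite_set_history_pmf[OF assms(1,2)] by auto

lemma expectation_joint_pmf:
  fixes X :: "'z list \<times> ('v \<times> 's) list \<Rightarrow> real"
  assumes "finite A" "is_policy A \<pi>" "finite (set_pmf \<mu>)"
  shows "measure_pmf.expectation (joint_pmf \<Phi> \<mu> \<pi> t) X
    = measure_pmf.expectation \<mu> (\<lambda>zs. measure_pmf.expectation (history_pmf \<Phi> \<pi> zs t) (\<lambda>h. X (zs, h)))"
  unfolding joint_pmf_def using assms(3) finite_set_history_pmf[OF assms(1,2)]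
  by (subst expectation_bind_finite) auto

lemma joint_pmf_Suc:
  "joint_pmf \<Phi> \<mu> \<pi> (Suc t) = bind_pmf (joint_pmf \<Phi> \<mu> \<pi> t)
     (\<lambda>(zs, h). map_pmf (\<lambda>a. (zs, h @ [(a, \<Phi> a (zs ! t))])) (\<pi> h))"
  by (simp add: joint_pmf_def bind_assoc_pmf map_bind_pmf bind_map_pmf map_pmf_comp)

text \<open>The latent sequence and the action determine the signal, so only \<open>(zs, h)\<close>
  can lead to the extended pair. The remaining factor \<open>pmf (\<pi> h) a\<close> does not
  involve \<open>zs\<close>.\<close>

lemma pmf_joint_pmf_snoc:
  "pmf (joint_pmf \<Phi> \<mu> \<pi> (Suc t)) (zs, h @ [(a, s)])
    = (if \<Phi> a (zs ! t) = s then pmf (joint_pmf \<Phi> \<mu> \<pi> t) (zs, h) * pmf (\<pi> h) a else 0)"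
proof -
  let ?X = "\<lambda>(zs', h'). pmf (map_pmf (\<lambda>a. (zs', h' @ [(a, \<Phi> a (zs' ! t))])) (\<pi> h')) (zs, h @ [(a, s)])"
  have X: "?X (zs', h') = (if zs' = zs \<and> h' = h \<and> \<Phi> a (zs ! t) = s then pmf (\<pi> h) a else 0)" for zs' h'
  proof -
    have "(\<lambda>a. (zs', h' @ [(a, \<Phi> a (zs' ! t))])) -` {(zs, h @ [(a, s)])}
      = (if zs' = zs \<and> h' = h \<and> \<Phi> a (zs ! t) = s then {a} else {})"
      by auto
    thus ?thesis by (simp add: pmf_map measure_pmf_single)
  qed
  have "pmf (joint_pmf \<Phi> \<mu> \<pi> (Suc t)) (zs, h @ [(a, s)])
      = measure_pmf.expectation (joint_pmf \<Phi> \<mu> \<pi> t) ?X"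
    unfolding joint_pmf_Suc pmf_bind by (intro Bochner_Integration.integral_cong) auto
  also have "\<dots> = (\<Sum>x\<in>{(zs, h)}. ?X x * pmf (joint_pmf \<Phi> \<mu> \<pi> t) x)"
  proof (rule integral_measure_pmf_real)
    fix x assume "?X x \<noteq> 0"
    thus "x \<in> {(zs, h)}"
      using X[of "fst x" "snd x"] by (simp add: case_prod_beta prod_eq_iff split: if_splits)
  qed simp
  finally show ?thesis by (simp add: X[unfolded prod.case])
qed

lemma cond_joint_pmf_eq_posterior:
  assumes "h \<in> snd ` set_pmf (joint_pmf \<Phi> \<mu> \<pi> (length h))"
  shows "cond_pmf (joint_pmf \<Phi> \<mu> \<pi> (length h)) {\<omega>. snd \<omega> = h} = map_pmf (\<lambda>zs. (zs, h)) (posterior \<Phi> \<mu> \<pi> h)"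
proof -
  let ?C = "cond_pmf (joint_pmf \<Phi> \<mu> \<pi> (length h)) {\<omega>. snd \<omega> = h}"
  have "set_pmf ?C = set_pmf (joint_pmf \<Phi> \<mu> \<pi> (length h)) \<inter> {\<omega>. snd \<omega> = h}"
    using assms by (intro set_cond_pmf) auto
  hence "map_pmf (\<lambda>\<omega>. (fst \<omega>, h)) ?C = map_pmf (\<lambda>\<omega>. \<omega>) ?C"
    by (intro map_pmf_cong) auto
  thus ?thesis by (simp add: posterior_def map_pmf_comp)
qed

lemma pmf_posterior:
  assumes "h \<in> snd ` set_pmf (joint_pmf \<Phi> \<mu> \<pi> (length h))"
  shows "pmf (posterior \<Phi> \<mu> \<pi> h) zs = pmf (joint_pmf \<Phi> \<mu> \<pi> (length h)) (zs, h)
    / measure_pmf.prob (joint_pmf \<Phi> \<mu> \<pi> (length h)) {\<omega>. snd \<omega> = h}"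
proof -
  have "pmf (posterior \<Phi> \<mu> \<pi> h) zs = pmf (map_pmf (\<lambda>zs. (zs, h)) (posterior \<Phi> \<mu> \<pi> h)) (zs, h)"
    by (rule pmf_map_inj'[symmetric]) (simp add: inj_def)
  also have "\<dots> = pmf (cond_pmf (joint_pmf \<Phi> \<mu> \<pi> (length h)) {\<omega>. snd \<omega> = h}) (zs, h)"
    by (simp only: cond_joint_pmf_eq_posterior[OF assms])
  also have "\<dots> = pmf (joint_pmf \<Phi> \<mu> \<pi> (length h)) (zs, h)
    / measure_pmf.prob (joint_pmf \<Phi> \<mu> \<pi> (length h)) {\<omega>. snd \<omega> = h}"
    using assms by (subst pmf_cond) auto
  finally show ?thesis .
qed

lemma set_posterior:
  assumes "h \<in> snd ` set_pmf (joint_pmf \<Phi> \<mu> \<pi> (length h))"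
  shows "set_pmf (posterior \<Phi> \<mu> \<pi> h) = {zs. (zs, h) \<in> set_pmf (joint_pmf \<Phi> \<mu> \<pi> (length h))}"
proof -
  have "set_pmf (cond_pmf (joint_pmf \<Phi> \<mu> \<pi> (length h)) {\<omega>. snd \<omega> = h})
      = set_pmf (joint_pmf \<Phi> \<mu> \<pi> (length h)) \<inter> {\<omega>. snd \<omega> = h}"
    using assms by (intro set_cond_pmf) auto
  thus ?thesis by (force simp: posterior_def)
qed

text \<open>This is the Bayes update of one round. The policy sees only the history, so the
  probability of the action is common to all latent sequences and disappears in the normalisation;
  what remains is conditioning on the signal.\<close>

lemma posterior_snoc:
  fixes h :: "('v \<times> 's) list"
  assumes "(zs, h) \<in> set_pmf (joint_pmf \<Phi> \<mu> \<pi> (length h))" "a \<in> set_pmf (\<pi> h)"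
  shows "posterior \<Phi> \<mu> \<pi> (h @ [(a, \<Phi> a (zs ! length h))])
    = cond_pmf (posterior \<Phi> \<mu> \<pi> h) {zs'. \<Phi> a (zs' ! length h) = \<Phi> a (zs ! length h)}"
proof -
  define t where "t = length h"
  define s where "s = \<Phi> a (zs ! t)"
  let ?S = "{zs'. \<Phi> a (zs' ! t) = s}" and ?P = "posterior \<Phi> \<mu> \<pi> h"
  have h: "h \<in> snd ` set_pmf (joint_pmf \<Phi> \<mu> \<pi> (length h))" using assms(1) by force
  have zsP: "zs \<in> set_pmf ?P" using assms(1) by (simp add: set_posterior[OF h])
  have "(zs, h @ [(a, s)]) \<in> set_pmf (joint_pmf \<Phi> \<mu> \<pi> (Suc t))"
    unfolding joint_pmf_Suc using assms by (force simp: t_def s_def)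
  hence h': "h @ [(a, s)] \<in> snd ` set_pmf (joint_pmf \<Phi> \<mu> \<pi> (length (h @ [(a, s)])))"
    by (force simp: t_def)
  let ?m = "measure_pmf.prob (joint_pmf \<Phi> \<mu> \<pi> (Suc t)) {\<omega>. snd \<omega> = h @ [(a, s)]}"
    and ?k = "measure_pmf.prob (joint_pmf \<Phi> \<mu> \<pi> t) {\<omega>. snd \<omega> = h}"
  have pos: "0 < ?k" "0 < measure_pmf.prob ?P ?S"
    by (rule measure_pmf_posI[of "(zs, h)"]) (use assms t_def in auto,
        rule measure_pmf_posI[of zs], use zsP s_def in auto)
  have ne: "set_pmf ?P \<inter> ?S \<noteq> {}" using zsP s_def by auto
  have "posterior \<Phi> \<mu> \<pi> (h @ [(a, s)]) = cond_pmf ?P ?S"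
  proof (rule pmf_eqI_proportional)
    fix x
    have "pmf (posterior \<Phi> \<mu> \<pi> (h @ [(a, s)])) x
        = (if \<Phi> a (x ! t) = s then pmf (joint_pmf \<Phi> \<mu> \<pi> t) (x, h) * pmf (\<pi> h) a else 0) / ?m"
      using pmf_posterior[OF h', of x] by (simp add: pmf_joint_pmf_snoc flip: t_def)
    also have "\<dots> = (pmf (\<pi> h) a * ?k * measure_pmf.prob ?P ?S / ?m) * pmf (cond_pmf ?P ?S) x"
      using pos by (simp add: pmf_cond[OF ne] pmf_posterior[OF h] flip: t_def)
    finally show "pmf (posterior \<Phi> \<mu> \<pi> (h @ [(a, s)])) x
        = (pmf (\<pi> h) a * ?k * measure_pmf.prob ?P ?S / ?m) * pmf (cond_pmf ?P ?S) x" .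
  qed
  thus ?thesis by (simp add: s_def t_def)
qed

lemma expectation_joint_posterior:
  fixes X :: "'z list \<times> ('v \<times> 's) list \<Rightarrow> real"
  assumes "finite A" "is_policy A \<pi>" "finite (set_pmf \<mu>)"
  shows "measure_pmf.expectation (joint_pmf \<Phi> \<mu> \<pi> t) X
    = measure_pmf.expectation (map_pmf snd (joint_pmf \<Phi> \<mu> \<pi> t))
        (\<lambda>h. measure_pmf.expectation (posterior \<Phi> \<mu> \<pi> h) (\<lambda>zs. X (zs, h)))"
proof -
  let ?J = "joint_pmf \<Phi> \<mu> \<pi> t"
  have "measure_pmf.expectation ?J X = measure_pmf.expectation (map_pmf snd ?J)
      (\<lambda>h. measure_pmf.expectation (cond_pmf ?J {\<omega>. snd \<omega> = h}) X)"
    by (rule expectation_tower) (rule finite_set_joint_pmf[OF assms])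
  also have "\<dots> = measure_pmf.expectation (map_pmf snd ?J)
        (\<lambda>h. measure_pmf.expectation (posterior \<Phi> \<mu> \<pi> h) (\<lambda>zs. X (zs, h)))"
  proof (rule expectation_cong_pmf)
    fix h assume h: "h \<in> set_pmf (map_pmf snd ?J)"
    hence t: "t = length h"
      using finite_set_history_pmf[OF assms(1,2)] by (fastforce simp: set_joint_pmf)
    show "measure_pmf.expectation (cond_pmf ?J {\<omega>. snd \<omega> = h}) X
        = measure_pmf.expectation (posterior \<Phi> \<mu> \<pi> h) (\<lambda>zs. X (zs, h))"
      using h unfolding t by (subst cond_joint_pmf_eq_posterior) auto
  qed
  finally show ?thesis .
qed

text \<open>Given the history, the action is independent of the latent sequence, so the average over
  the next history splits into one over actions and one over the posterior.\<close>

lemma expectation_next_history: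
  fixes X :: "('v \<times> 's) list \<Rightarrow> real"
  assumes "finite A" "is_policy A \<pi>" "finite (set_pmf \<mu>)"
  shows "measure_pmf.expectation (map_pmf snd (joint_pmf \<Phi> \<mu> \<pi> (Suc t))) X
    = measure_pmf.expectation (map_pmf snd (joint_pmf \<Phi> \<mu> \<pi> t))
        (\<lambda>h. \<Sum>a\<in>A. pmf (\<pi> h) a *
           measure_pmf.expectation (posterior \<Phi> \<mu> \<pi> h) (\<lambda>zs. X (h @ [(a, \<Phi> a (zs ! t))])))"
proof -
  let ?J = "joint_pmf \<Phi> \<mu> \<pi> t"
  have "measure_pmf.expectation (map_pmf snd (joint_pmf \<Phi> \<mu> \<pi> (Suc t))) X
    = measure_pmf.expectation ?J (\<lambda>(zs, h). \<Sum>a\<in>A. pmf (\<pi> h) a * X (h @ [(a, \<Phi> a (zs ! t))]))"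
    using assms by (simp add: expectation_joint_pmf expectation_history_Suc del: history_pmf.simps)
  also have "\<dots> = measure_pmf.expectation (map_pmf snd ?J)
        (\<lambda>h. measure_pmf.expectation (posterior \<Phi> \<mu> \<pi> h)
           (\<lambda>zs. \<Sum>a\<in>A. pmf (\<pi> h) a * X (h @ [(a, \<Phi> a (zs ! t))])))"
    by (subst expectation_joint_posterior[OF assms]) simp
  also have "\<dots> = measure_pmf.expectation (map_pmf snd ?J)
        (\<lambda>h. \<Sum>a\<in>A. pmf (\<pi> h) a *
           measure_pmf.expectation (posterior \<Phi> \<mu> \<pi> h) (\<lambda>zs. X (h @ [(a, \<Phi> a (zs ! t))])))"
  proof (rule expectation_cong_pmf)
    fix h assume h: "h \<in> set_pmf (map_pmf snd ?J)"
    hence t: "t = length h"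
      using finite_set_history_pmf[OF assms(1,2)] by (fastforce simp: set_joint_pmf)
    have "set_pmf (posterior \<Phi> \<mu> \<pi> h) \<subseteq> fst ` set_pmf ?J"
      using h unfolding t by (subst set_posterior) force+
    hence "finite (set_pmf (posterior \<Phi> \<mu> \<pi> h))"
      using finite_set_joint_pmf[OF assms] finite_subset by blast
    thus "measure_pmf.expectation (posterior \<Phi> \<mu> \<pi> h)
           (\<lambda>zs. \<Sum>a\<in>A. pmf (\<pi> h) a * X (h @ [(a, \<Phi> a (zs ! t))]))
        = (\<Sum>a\<in>A. pmf (\<pi> h) a *
           measure_pmf.expectation (posterior \<Phi> \<mu> \<pi> h) (\<lambda>zs. X (h @ [(a, \<Phi> a (zs ! t))])))"
      by (subst Bochner_Integration.integral_sum) (auto intro: integrable_measure_pmf_finite)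
  qed
  finally show ?thesis .
qed

subsection \<open>Regret of information-directed sampling\<close>

lemma expectation_pair_pmf:
  fixes X :: "'w \<times> 'a \<Rightarrow> 'v::{banach, second_countable_topology}"
  assumes "finite A" "set_pmf q \<subseteq> A" "finite (set_pmf \<nu>)"
  shows "measure_pmf.expectation (pair_pmf \<nu> q) X
    = (\<Sum>a\<in>A. pmf q a *\<^sub>R measure_pmf.expectation \<nu> (\<lambda>x. X (x, a)))"
proof -
  \<comment> \<open>Drawing the action first turns the expectation into a finite sum over
    actions.\<close>
  have "pair_pmf \<nu> q = bind_pmf q (\<lambda>a. map_pmf (\<lambda>x. (x, a)) \<nu>)"
    unfolding pair_pmf_def map_pmf_def by (rule bind_commute_pmf)
  thus ?thesis using pmf_expectation_bind[OF assms(1), of "\<lambda>a. map_pmf (\<lambda>x. (x, a)) \<nu>" q X] assms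
    by simp
qed

text \<open>Observing a signal together with the action is an event of the form
  \<open>S \<times> {a}\<close>; by independence it conditions the first component on
  \<open>S\<close> and fixes the second.\<close>

lemma cond_pair_pmf_snd:
  assumes "set_pmf \<nu> \<inter> S \<noteq> {}" "a \<in> set_pmf q"
  shows "cond_pmf (pair_pmf \<nu> q) (S \<times> {a}) = map_pmf (\<lambda>x. (x, a)) (cond_pmf \<nu> S)"
proof (rule pmf_eqI_proportional)
  fix y :: "'a \<times> 'b"
  obtain x a' where y: "y = (x, a')" by fastforce
  have ne: "set_pmf (pair_pmf \<nu> q) \<inter> S \<times> {a} \<noteq> {}" using assms by auto
  have pos: "0 < measure_pmf.prob \<nu> S" using assms(1) measure_pmf_posI by fast
  show "pmf (cond_pmf (pair_pmf \<nu> q) (S \<times> {a})) y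
      = (pmf q a * measure_pmf.prob \<nu> S / measure_pmf.prob (pair_pmf \<nu> q) (S \<times> {a}))
        * pmf (map_pmf (\<lambda>x. (x, a)) (cond_pmf \<nu> S)) y"
  proof (cases "a' = a")
    case True
    have "pmf (map_pmf (\<lambda>x. (x, a)) (cond_pmf \<nu> S)) (x, a) = pmf (cond_pmf \<nu> S) x"
      by (rule pmf_map_inj') (simp add: inj_def)
    thus ?thesis using True pos
      by (simp add: y pmf_cond[OF ne] pmf_cond[OF assms(1)] pmf_pair)
  next
    case False
    hence "pmf (map_pmf (\<lambda>x. (x, a)) (cond_pmf \<nu> S)) (x, a') = 0"
      by (intro pmf_map_outside) auto
    thus ?thesis using False by (simp add: y pmf_cond[OF ne])
  qed
qed

text \<open>The condition is applied to the image of \<open>Q\<close> under the map to the current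
  latent state and \<open>A*\<close>. This forgets the rest of the sequence, but neither the gap nor
  the information gain of the round depends on it.\<close>

lemma has_info_ratio_posterior:
  fixes A D :: "'v::euclidean_space set" and Astar :: "'z list \<Rightarrow> 'v"
  assumes ir: "has_info_ratio A Z \<Phi> loss F D 0 \<beta> l" and l: "l \<noteq> 1"
    and A: "finite A" and Q: "finite (set_pmf Q)"
    and supp: "\<And>zs. zs \<in> set_pmf Q \<Longrightarrow> zs ! t \<in> Z \<and> Astar zs \<in> D"
  obtains q where "set_pmf q \<subseteq> A"
    and "(\<Sum>a\<in>A. pmf q a * exp_gap loss Astar Q t a)
      \<le> \<beta> powr (1 - 1 / l) * (\<Sum>a\<in>A. pmf q a * info_gain \<Phi> F Astar Q t a) powr (1 / l)"
proof -
  define g where "g zs = (zs ! t, Astar zs)" for zs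
  define \<nu> where "\<nu> = map_pmf g Q"
  have \<nu>: "finite (set_pmf \<nu>)" "set_pmf \<nu> \<subseteq> Z \<times> D"
    using Q supp by (auto simp: \<nu>_def g_def)
  let ?A = "\<lambda>((z, b), a). b" and ?obs = "\<lambda>((z, b), a). (\<Phi> a z, a)"
  let ?E = "measure_pmf.expectation"
  obtain q where q: "set_pmf q \<subseteq> A" and le:
    "?E (pair_pmf \<nu> q) (\<lambda>((z, b), a). (a - b) \<bullet> loss z) \<le> \<beta> powr (1 - 1 / l) *
      ?E (pair_pmf \<nu> q) (\<lambda>\<omega>. real_of_ereal (bregman F (cond_exp_pmf (pair_pmf \<nu> q) ?A ?obs \<omega>)
        (?E (pair_pmf \<nu> q) ?A))) powr (1 / l)"
    using ir \<nu> l unfolding has_info_ratio_def Let_def by auto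
  have gap: "?E (pair_pmf \<nu> q) (\<lambda>((z, b), a). (a - b) \<bullet> loss z)
      = (\<Sum>a\<in>A. pmf q a * exp_gap loss Astar Q t a)"
    by (subst expectation_pair_pmf[OF A q \<nu>(1)]) (simp add: exp_gap_def \<nu>_def g_def)
  have mean: "?E (pair_pmf \<nu> q) ?A = ?E Q Astar"
    by (subst expectation_pair_pmf[OF A q \<nu>(1)])
       (simp add: \<nu>_def g_def sum_pmf_eq_1[OF A q] flip: scaleR_sum_left)
  have cond: "cond_exp_pmf (pair_pmf \<nu> q) ?A ?obs (g zs, a)
      = cond_exp_pmf Q Astar (\<lambda>zs'. \<Phi> a (zs' ! t)) zs"
    if zs: "zs \<in> set_pmf Q" and a: "a \<in> set_pmf q" for zs a
  proof -
    let ?S = "{x. \<Phi> a (fst x) = \<Phi> a (zs ! t)}"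
    have S: "{\<omega>. ?obs \<omega> = ?obs (g zs, a)} = ?S \<times> {a}"
      by (auto simp: g_def)
    have "set_pmf \<nu> \<inter> ?S \<noteq> {}"
      using zs by (auto simp: \<nu>_def g_def)
    from cond_pair_pmf_snd[OF this a]
    have "cond_exp_pmf (pair_pmf \<nu> q) ?A ?obs (g zs, a) = ?E (cond_pmf \<nu> ?S) snd"
      unfolding cond_exp_pmf_def S by (simp add: case_prod_beta)
    also have "cond_pmf \<nu> ?S = map_pmf g (cond_pmf Q (g -` ?S))"
      unfolding \<nu>_def by (rule cond_map_pmf) (use zs in \<open>auto simp: g_def\<close>)
    finally show ?thesis by (simp add: cond_exp_pmf_def g_def vimage_def)
  qed
  have info: "?E (pair_pmf \<nu> q) (\<lambda>\<omega>. real_of_ereal (bregman F (cond_exp_pmf (pair_pmf \<nu> q) ?A ?obs \<omega>)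
        (?E (pair_pmf \<nu> q) ?A))) = (\<Sum>a\<in>A. pmf q a * info_gain \<Phi> F Astar Q t a)"
    unfolding mean unfolding expectation_pair_pmf[OF A q \<nu>(1)]
  proof (rule sum.cong[OF refl])
    fix a
    have "?E \<nu> (\<lambda>x. real_of_ereal (bregman F (cond_exp_pmf (pair_pmf \<nu> q) ?A ?obs (x, a)) (?E Q Astar)))
        = info_gain \<Phi> F Astar Q t a" if "a \<in> set_pmf q"
      unfolding \<nu>_def info_gain_def integral_map_pmf
      unfolding \<nu>_def[symmetric] by (rule expectation_cong_pmf) (simp only: cond that)
    thus "pmf q a *\<^sub>R ?E \<nu> (\<lambda>x. real_of_ereal (bregman F (cond_exp_pmf (pair_pmf \<nu> q) ?A ?obs (x, a)) (?E Q Astar)))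
        = pmf q a * info_gain \<Phi> F Astar Q t a"
      \<comment> \<open>Off the support of \<open>q\<close> the conditioning event has probability
        zero, but such actions carry weight zero.\<close>
      by (cases "a \<in> set_pmf q") (simp_all add: set_pmf_iff)
  qed
  have "(\<Sum>a\<in>A. pmf q a * exp_gap loss Astar Q t a)
      \<le> \<beta> powr (1 - 1 / l) * (\<Sum>a\<in>A. pmf q a * info_gain \<Phi> F Astar Q t a) powr (1 / l)"
    using le by (simp only: gap info)
  thus thesis by (rule that[OF q])
qed

text \<open>The conditional means of \<open>A*\<close> have the mean of \<open>A*\<close> as their
  own average, so \<open>expected_bregman\<close> applies to them. The upper bound makes the gains
  telescope.\<close>

lemma info_gain_bounds:
  fixes F :: "'v::euclidean_space \<Rightarrow> ereal" and Astar :: "'z list \<Rightarrow> 'v"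
  defines "f \<equiv> \<lambda>x. real_of_ereal (F x)"
  assumes F: "proper_fun F" "convex_fun F" and D: "convex D" "D \<subseteq> edom F"
    and Q: "finite (set_pmf Q)" "\<And>zs. zs \<in> set_pmf Q \<Longrightarrow> Astar zs \<in> D"
  shows "info_gain \<Phi> F Astar Q t a
      \<le> measure_pmf.expectation Q (\<lambda>zs. f (cond_exp_pmf Q Astar (\<lambda>zs'. \<Phi> a (zs' ! t)) zs))
        - f (measure_pmf.expectation Q Astar)"
    and "0 \<le> info_gain \<Phi> F Astar Q t a"
proof -
  let ?X = "cond_exp_pmf Q Astar (\<lambda>zs'. \<Phi> a (zs' ! t))"
  have X: "?X zs \<in> D" if "zs \<in> set_pmf Q" for zs
    by (rule cond_exp_pmf_in_convex[OF Q(1) D(1)]) (use Q that in auto)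
  have "measure_pmf.expectation Q Astar = measure_pmf.expectation Q ?X"
    by (rule expectation_cond_exp_pmf[OF Q(1), symmetric])
  note * = expected_bregman[OF F D Q(1) X this]
  show "info_gain \<Phi> F Astar Q t a
      \<le> measure_pmf.expectation Q (\<lambda>zs. f (?X zs)) - f (measure_pmf.expectation Q Astar)"
    and "0 \<le> info_gain \<Phi> F Astar Q t a"
    using * unfolding f_def info_gain_def by auto
qed

section \<open>The diameter and the approximation error\<close>

lemma potential_diam_bound:
  assumes F: "proper_fun F" and D: "D \<subseteq> edom F" "potential_diam F D < \<infinity>" and xy: "x \<in> D" "y \<in> D"
  shows "real_of_ereal (F x) - real_of_ereal (F y) \<le> real_of_ereal (potential_diam F D)"
proof -
  have le: "F u - F v \<le> potential_diam F D" if "u \<in> D" "v \<in> D" for u v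
    unfolding potential_diam_def using that by (intro SUP_upper2[of "(u, v)"]) auto
  have fin: "F z = ereal (real_of_ereal (F z))" if "z \<in> D" for z
    using edom_finite[OF F] that D(1) by blast
  have "ereal (real_of_ereal (F x) - real_of_ereal (F y)) \<le> potential_diam F D"
    using le[OF xy] fin[OF xy(1)] fin[OF xy(2)] by (metis ereal_minus(1))
  thus ?thesis using D(2) by (cases "potential_diam F D") auto
qed

text \<open>By minimality \<open>b0\<close> may be replaced by any \<open>b\<close> in
  \<open>D\<close>, after which every round costs at most the supremum over latent states. Taking
  the infimum over \<open>b\<close> last avoids choosing a best approximation of
  \<open>a\<close>.\<close>

lemma approx_error_bound:
  fixes A D :: "'v::real_inner set"
  assumes A: "finite A" "a \<in> A" and D: "D \<subseteq> convex hull A" "D \<noteq> {}"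
    and bnd: "\<And>a z. a \<in> A \<Longrightarrow> z \<in> Z \<Longrightarrow> a \<bullet> loss z \<in> {0..1}"
    and zs: "length zs = n" "set zs \<subseteq> Z" and n: "0 < n"
    and min: "is_arg_min (\<lambda>a. \<Sum>t<n. a \<bullet> loss (zs ! t)) (\<lambda>a. a \<in> D) b0"
  shows "(\<Sum>t<n. (b0 - a) \<bullet> loss (zs ! t)) \<le> real n * approx_error A Z loss D"
proof -
  have Zt: "zs ! t \<in> Z" if "t < n" for t using zs that by (auto dest: nth_mem)
  have hull: "b \<bullet> loss z \<in> {0..1}" if "b \<in> convex hull A" "z \<in> Z" for b z
  proof -
    have "convex {b. b \<bullet> loss z \<in> {0..1}}"
    proof -
      have "{b. b \<bullet> loss z \<in> {0..1}} = (\<lambda>b. loss z \<bullet> b) -` {0..1}"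
        by (auto simp: inner_commute)
      thus ?thesis by (simp add: convex_linear_vimage bounded_linear.linear[OF bounded_linear_inner_right])
    qed
    hence "convex hull A \<subseteq> {b. b \<bullet> loss z \<in> {0..1}}"
      using bnd that(2) by (intro hull_minimal) auto
    thus ?thesis using that by blast
  qed
  \<comment> \<open>The suprema are over sets of reals and need an upper bound; it comes from
    extending the loss bounds to the convex hull.\<close>
  have le1: "(b - a) \<bullet> loss z \<le> 1" if "b \<in> D" "z \<in> Z" for b z
    using hull[of b z] bnd[OF A(2), of z] that D(1) by (auto simp: inner_diff_left)
  have "(\<Sum>t<n. (b0 - a) \<bullet> loss (zs ! t)) / n \<le> (SUP z\<in>Z. (b - a) \<bullet> loss z)" if b: "b \<in> D" for b
  proof -
    have "(\<Sum>t<n. b0 \<bullet> loss (zs ! t)) \<le> (\<Sum>t<n. b \<bullet> loss (zs ! t))"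
      using min b unfolding is_arg_min_def by (meson not_le)
    hence "(\<Sum>t<n. (b0 - a) \<bullet> loss (zs ! t)) \<le> (\<Sum>t<n. (b - a) \<bullet> loss (zs ! t))"
      by (simp add: inner_diff_left sum_subtractf)
    also have "\<dots> \<le> (\<Sum>t<n. SUP z\<in>Z. (b - a) \<bullet> loss z)"
      using le1[OF b] Zt by (intro sum_mono cSUP_upper bdd_aboveI2[of _ _ 1]) auto
    finally show ?thesis using n by (simp add: field_simps)
  qed
  hence "(\<Sum>t<n. (b0 - a) \<bullet> loss (zs ! t)) / n \<le> (INF b\<in>D. SUP z\<in>Z. (b - a) \<bullet> loss z)"
    using D(2) by (intro cINF_greatest) auto
  also have "\<dots> \<le> approx_error A Z loss D"
    unfolding approx_error_def using A by (intro Max_ge) auto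
  finally show ?thesis using n by (simp add: field_simps)
qed

theorem theorem6:
  fixes A D :: "(real ^ 'd) set"
    and Z :: "'z set"
    and \<Phi> :: "real ^ 'd \<Rightarrow> 'z \<Rightarrow> 's"
    and loss :: "'z \<Rightarrow> real ^ 'd"
    and F :: "real ^ 'd \<Rightarrow> ereal"
    and \<beta> l :: real
    and n :: nat
    and \<mu> :: "'z list pmf"
    and Astar :: "'z list \<Rightarrow> real ^ 'd"
    and \<pi> :: "(real ^ 'd, 's) policy"
  assumes loss_cube: "\<And>z i. z \<in> Z \<Longrightarrow> loss z $ i \<in> {0..1}"
    and F_legendre: "legendre F"
    and D_subset: "D \<subseteq> convex hull A"
    and D_compact: "compact D"
    and D_convex: "convex D"
    and D_rel_interior: "rel_interior D \<noteq> {}"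
    and A_finite: "finite A"
    and A_card: "1 < card A"
    and loss_bounds: "\<And>a z. a \<in> A \<Longrightarrow> z \<in> Z \<Longrightarrow> a \<bullet> loss z \<in> {0..1}"
    and D_edom: "D \<subseteq> edom F"
    and diam_finite: "potential_diam F D < \<infinity>"
    and beta_nonneg: "0 \<le> \<beta>"
    and lambda_ge: "2 \<le> l"
    and info_ratio: "has_info_ratio A Z \<Phi> loss F D 0 \<beta> l"
    and n_pos: "1 \<le> n"
    and prior_finite: "finite (set_pmf \<mu>)"
    and prior_support: "set_pmf \<mu> \<subseteq> {zs. length zs = n \<and> set zs \<subseteq> Z}"
    and selection: "optimal_selection Z loss D n Astar"
    and ids: "is_ids A \<Phi> loss F Astar n \<mu> \<pi>"
  shows "bayes_regret A \<Phi> loss \<pi> \<mu>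
     \<le> real n * approx_error A Z loss D
       + l powr (1 - 2 / l) * (\<beta> * real n) powr (1 - 1 / l)
         * real_of_ereal (potential_diam F D) powr (1 / l)"
proof -
  let ?E = "measure_pmf.expectation"
  let ?H = "\<lambda>t. map_pmf snd (joint_pmf \<Phi> \<mu> \<pi> t)"
  let ?P = "posterior \<Phi> \<mu> \<pi>"
  define f where "f x = real_of_ereal (F x)" for x
  define G where "G t h = (\<Sum>a\<in>A. pmf (\<pi> h) a * exp_gap loss Astar (?P h) t a)" for t h
  define J where "J t h = (\<Sum>a\<in>A. pmf (\<pi> h) a * info_gain \<Phi> F Astar (?P h) t a)" for t h
  \<comment> \<open>\<open>V\<close> is the potential at the posterior mean of \<open>A*\<close>;
    its expected increments will dominate the information gains.\<close>
  define V where "V h = f (?E (?P h) Astar)" for h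
  define dm where "dm = real_of_ereal (potential_diam F D)"
  define c where "c = 2 powr (1 - 2 / l) * \<beta> powr (1 - 1 / l)"
  have F: "proper_fun F" "convex_fun F" using F_legendre by (auto simp: legendre_def)
  have pol: "is_policy A \<pi>" using ids by (simp add: is_ids_def)
  note fin = A_finite pol prior_finite
  have D_ne: "D \<noteq> {}" using D_rel_interior rel_interior_subset by blast
  have prior: "length zs = n" "set zs \<subseteq> Z"
      "is_arg_min (\<lambda>a. \<Sum>t<n. a \<bullet> loss (zs ! t)) (\<lambda>a. a \<in> D) (Astar zs)" "Astar zs \<in> D"
    if "zs \<in> set_pmf \<mu>" for zs
    using that prior_support selection unfolding optimal_selection_def is_arg_min_def by blast+
  have hist: "h \<in> snd ` set_pmf (joint_pmf \<Phi> \<mu> \<pi> (length h))" "length h = t" "set_pmf (\<pi> h) \<subseteq> A"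
    if "h \<in> set_pmf (?H t)" for t h
  proof -
    obtain zs where "h \<in> set_pmf (history_pmf \<Phi> \<pi> zs t)"
      using \<open>h \<in> set_pmf (?H t)\<close> by (auto simp: set_joint_pmf)
    thus len: "length h = t" and "set_pmf (\<pi> h) \<subseteq> A"
      using finite_set_history_pmf[OF fin(1,2)] pol unfolding is_policy_def by blast+
    show "h \<in> snd ` set_pmf (joint_pmf \<Phi> \<mu> \<pi> (length h))"
      unfolding len using \<open>h \<in> set_pmf (?H t)\<close> by simp
  qed
  have H_fin: "finite (set_pmf (?H t))" for t
    using finite_set_joint_pmf[OF fin] by simp
  have post: "finite (set_pmf (?P h))" "set_pmf (?P h) \<subseteq> set_pmf \<mu>" if "h \<in> set_pmf (?H t)" for t h
  proof -
    show "set_pmf (?P h) \<subseteq> set_pmf \<mu>"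
      unfolding set_posterior[OF hist(1)[OF that]] by (auto simp: set_joint_pmf)
    thus "finite (set_pmf (?P h))" using prior_finite finite_subset by blast
  qed
  have AstarD: "Astar zs \<in> D" if "h \<in> set_pmf (?H t)" "zs \<in> set_pmf (?P h)" for t h zs
    using prior(4) post(2) that by blast

  have J_nonneg: "0 \<le> info_gain \<Phi> F Astar (?P h) s a" if "h \<in> set_pmf (?H t)" for t h s a
    using info_gain_bounds(2)[OF F D_convex D_edom post(1)[OF that] AstarD[OF that]] .
  \<comment> \<open>At each history of positive probability, the information ratio at the posterior
    supplies the competitor \<open>q\<close> against which the minimising policy is
    compared.\<close>
  have round: "G t h \<le> c * J t h powr (1 / l)" if t: "t < n" and h: "h \<in> set_pmf (?H t)" for t h
  proof -
    have "zs ! t \<in> Z" if "zs \<in> set_pmf (?P h)" for zs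
      using prior(1,2) post(2)[OF h] that t nth_mem by blast
    then obtain q where q: "set_pmf q \<subseteq> A" "(\<Sum>a\<in>A. pmf q a * exp_gap loss Astar (?P h) t a)
      \<le> \<beta> powr (1 - 1 / l) * (\<Sum>a\<in>A. pmf q a * info_gain \<Phi> F Astar (?P h) t a) powr (1 / l)"
      using has_info_ratio_posterior[OF info_ratio _ A_finite post(1)[OF h], of t Astar]
        AstarD[OF h] lambda_ge by force
    have "is_arg_min (ids_objective A (exp_gap loss Astar (?P h) t) (info_gain \<Phi> F Astar (?P h) t))
             (\<lambda>p. set_pmf p \<subseteq> A) (\<pi> h)"
      using ids t h unfolding is_ids_def Let_def set_map_pmf by blast
    from ids_gap_bound[OF this J_nonneg[OF h] lambda_ge beta_nonneg q]
    show ?thesis unfolding G_def J_def c_def .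
  qed

  \<comment> \<open>By the Bayes update, \<open>V\<close> after one more round is the potential at a
    conditional mean, so the round's information gain is at most the expected increase of
    \<open>V\<close>.\<close>
  have gain: "?E (?H t) (J t) \<le> ?E (?H (Suc t)) V - ?E (?H t) V" for t
  proof -
    have step: "J t h + V h \<le> (\<Sum>a\<in>A. pmf (\<pi> h) a * ?E (?P h) (\<lambda>zs. V (h @ [(a, \<Phi> a (zs ! t))])))"
      if h: "h \<in> set_pmf (?H t)" for h
    proof -
      have one: "(\<Sum>a\<in>A. pmf (\<pi> h) a) = 1"
        by (rule sum_pmf_eq_1[OF A_finite hist(3)[OF h]])
      have "pmf (\<pi> h) a * (info_gain \<Phi> F Astar (?P h) t a + V h)
          \<le> pmf (\<pi> h) a * ?E (?P h) (\<lambda>zs. V (h @ [(a, \<Phi> a (zs ! t))]))" for a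
      \<comment> \<open>The Bayes update is available only for actions of positive probability; for
        the others both sides are zero.\<close>
      proof (cases "a \<in> set_pmf (\<pi> h)")
        case True
        have "V (h @ [(a, \<Phi> a (zs ! t))]) = f (cond_exp_pmf (?P h) Astar (\<lambda>zs'. \<Phi> a (zs' ! t)) zs)"
          if "zs \<in> set_pmf (?P h)" for zs
        proof -
          have "(zs, h) \<in> set_pmf (joint_pmf \<Phi> \<mu> \<pi> (length h))"
            using that unfolding set_posterior[OF hist(1)[OF h]] by simp
          from posterior_snoc[of zs h \<Phi> \<mu> \<pi> a, OF this True] show ?thesis
            unfolding V_def cond_exp_pmf_def hist(2)[OF h] by simp
        qed
        hence "?E (?P h) (\<lambda>zs. V (h @ [(a, \<Phi> a (zs ! t))]))
            = ?E (?P h) (\<lambda>zs. f (cond_exp_pmf (?P h) Astar (\<lambda>zs'. \<Phi> a (zs' ! t)) zs))"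
          by (rule expectation_cong_pmf)
        moreover have "info_gain \<Phi> F Astar (?P h) t a
          \<le> ?E (?P h) (\<lambda>zs. f (cond_exp_pmf (?P h) Astar (\<lambda>zs'. \<Phi> a (zs' ! t)) zs)) - V h"
          using info_gain_bounds(1)[OF F D_convex D_edom post(1)[OF h] AstarD[OF h]]
          unfolding V_def f_def .
        ultimately show ?thesis by (intro mult_left_mono) auto
      qed (simp add: set_pmf_iff)
      hence "(\<Sum>a\<in>A. pmf (\<pi> h) a * (info_gain \<Phi> F Astar (?P h) t a + V h))
          \<le> (\<Sum>a\<in>A. pmf (\<pi> h) a * ?E (?P h) (\<lambda>zs. V (h @ [(a, \<Phi> a (zs ! t))])))"
        by (intro sum_mono)
      moreover have "(\<Sum>a\<in>A. pmf (\<pi> h) a * (info_gain \<Phi> F Astar (?P h) t a + V h)) = J t h + V h"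
        by (simp add: distrib_left sum.distrib J_def one flip: sum_distrib_right)
      ultimately show ?thesis by simp
    qed
    have "?E (?H t) (J t) + ?E (?H t) V = ?E (?H t) (\<lambda>h. J t h + V h)"
      by (rule Bochner_Integration.integral_add[symmetric]) (rule integrable_measure_pmf_finite[OF H_fin])+
    also have "\<dots> \<le> ?E (?H (Suc t)) V"
      unfolding expectation_next_history[OF fin] by (rule expectation_mono_pmf[OF H_fin step])
    finally show ?thesis by simp
  qed
  have "(\<Sum>t<n. ?E (?H t) (J t)) \<le> (\<Sum>t<n. ?E (?H (Suc t)) V - ?E (?H t) V)"
    by (intro sum_mono gain)
  also have "\<dots> = ?E (?H n) V - ?E (?H 0) V"
    by (rule sum_lessThan_telescope)
  also have "?E (?H 0) V = V []"
    by (simp add: joint_pmf_def map_bind_pmf)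
  \<comment> \<open>Every posterior mean lies in \<open>D\<close> by convexity, so the diameter
    bounds the difference from the initial potential at each final history.\<close>
  also have "?E (?H n) V - V [] \<le> dm"
  proof -
    have V: "?E (?P h) Astar \<in> D" if "h \<in> set_pmf (?H t)" for t h
      by (rule expectation_in_convex[OF post(1)[OF that] D_convex AstarD[OF that]])
    have nil: "[] \<in> set_pmf (?H 0)"
      using set_pmf_not_empty[of \<mu>] by (force simp: set_joint_pmf)
    have "V h \<le> V [] + dm" if "h \<in> set_pmf (?H n)" for h
      using potential_diam_bound[OF F(1) D_edom diam_finite V[OF that] V[OF nil]]
      by (simp add: V_def f_def dm_def)
    hence "?E (?H n) V \<le> ?E (?H n) (\<lambda>_. V [] + dm)"
      by (rule expectation_mono_pmf[OF H_fin])
    thus ?thesis by simp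
  qed
  finally have info_sum: "(\<Sum>t<n. ?E (?H t) (J t)) \<le> dm" .

  have "(\<Sum>t<n. ?E (?H t) (G t)) \<le> (\<Sum>t<n. ?E (?H t) (\<lambda>h. c * J t h powr (1 / l)))"
    using round H_fin by (intro sum_mono expectation_mono_pmf) auto
  also have "\<dots> = c * (\<Sum>t<n. ?E (?H t) (\<lambda>h. J t h powr (1 / l)))"
    by (simp add: sum_distrib_left)
  also have "\<dots> \<le> c * (real n powr (1 - 1 / l) * dm powr (1 / l))"
  proof (rule mult_left_mono[OF sum_expectation_powr_le[OF _ _ _ H_fin _ info_sum]])
    show "0 \<le> J t h" if "h \<in> set_pmf (?H t)" for t h
      unfolding J_def by (intro sum_nonneg mult_nonneg_nonneg pmf_nonneg J_nonneg[OF that])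
  qed (use n_pos lambda_ge in \<open>auto simp: c_def\<close>)
  also have "\<dots> \<le> l powr (1 - 2 / l) * (\<beta> * real n) powr (1 - 1 / l) * dm powr (1 / l)"
  proof -
    \<comment> \<open>The argument yields the constant with base 2; the stated base \<open>l\<close>
      is weaker because \<open>2 \<le> l\<close> and the exponent is nonnegative.\<close>
    have "2 powr (1 - 2 / l) \<le> l powr (1 - 2 / l)"
      using lambda_ge by (intro powr_mono2) auto
    thus ?thesis using beta_nonneg
      by (simp add: c_def powr_mult mult.assoc mult_right_mono)
  qed
  finally have G_sum: "(\<Sum>t<n. ?E (?H t) (G t))
      \<le> l powr (1 - 2 / l) * (\<beta> * real n) powr (1 - 1 / l) * dm powr (1 / l)" .

  let ?R = "\<lambda>zs a. ?E (history_pmf \<Phi> \<pi> zs n) (\<lambda>h. \<Sum>t<n. (fst (h ! t) - a) \<bullet> loss (zs ! t))"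
  \<comment> \<open>For each latent sequence separately, the comparator in \<open>A\<close> is
    exchanged for \<open>Astar zs\<close>, at the price of the approximation error in every
    round.\<close>
  have "bayes_regret A \<Phi> loss \<pi> \<mu> \<le> ?E \<mu> (\<lambda>zs. ?R zs (Astar zs) + real n * approx_error A Z loss D)"
    unfolding bayes_regret_def
  proof (rule expectation_mono_pmf[OF prior_finite])
    fix zs assume zs: "zs \<in> set_pmf \<mu>"
    have int: "integrable (history_pmf \<Phi> \<pi> zs n) (X :: _ \<Rightarrow> real)" for X
      using finite_set_history_pmf[OF fin(1,2)] by (intro integrable_measure_pmf_finite) blast
    have "?R zs a \<le> ?R zs (Astar zs) + real n * approx_error A Z loss D" if a: "a \<in> A" for a
    proof -
      have "?R zs a = ?E (history_pmf \<Phi> \<pi> zs n) (\<lambda>h. (\<Sum>t<n. (fst (h ! t) - Astar zs) \<bullet> loss (zs ! t))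
          + (\<Sum>t<n. (Astar zs - a) \<bullet> loss (zs ! t)))"
        by (simp add: inner_diff_left sum_subtractf)
      also have "\<dots> = ?R zs (Astar zs) + (\<Sum>t<n. (Astar zs - a) \<bullet> loss (zs ! t))"
        by (subst Bochner_Integration.integral_add[OF int int]) simp
      finally show ?thesis
        using approx_error_bound[OF A_finite a D_subset D_ne loss_bounds prior(1,2)[OF zs] _ prior(3)[OF zs]]
          n_pos by simp
    qed
    moreover have "A \<noteq> {}" using A_card by auto
    ultimately show "regret A \<Phi> loss \<pi> zs \<le> ?R zs (Astar zs) + real n * approx_error A Z loss D"
      unfolding regret_def prior(1)[OF zs] using A_finite by (subst Max_le_iff) auto
  qed
  also have "\<dots> = ?E \<mu> (\<lambda>zs. ?R zs (Astar zs)) + real n * approx_error A Z loss D"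
    by (subst Bochner_Integration.integral_add) (simp_all add: integrable_measure_pmf_finite[OF prior_finite])
  \<comment> \<open>The regret against \<open>A*\<close> is split into rounds; conditioning each
    round on its history replaces the loss difference by its posterior mean, which is the gap in
    \<open>G\<close>.\<close>
  also have "?E \<mu> (\<lambda>zs. ?R zs (Astar zs)) = (\<Sum>t<n. ?E (?H t) (G t))"
  proof -
    have "?E \<mu> (\<lambda>zs. ?R zs (Astar zs)) = ?E \<mu> (\<lambda>zs. \<Sum>t<n. ?E (history_pmf \<Phi> \<pi> zs t)
        (\<lambda>h. \<Sum>a\<in>A. pmf (\<pi> h) a * ((a - Astar zs) \<bullet> loss (zs ! t))))"
      by (subst expectation_history_sum[OF fin(1,2)]) simp
    also have "\<dots> = (\<Sum>t<n. ?E (joint_pmf \<Phi> \<mu> \<pi> t)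
        (\<lambda>(zs, h). \<Sum>a\<in>A. pmf (\<pi> h) a * ((a - Astar zs) \<bullet> loss (zs ! t))))"
      by (subst Bochner_Integration.integral_sum)
         (simp_all add: integrable_measure_pmf_finite[OF prior_finite] expectation_joint_pmf[OF fin])
    also have "\<dots> = (\<Sum>t<n. ?E (?H t) (G t))"
    proof (rule sum.cong[OF refl])
      fix t
      have "?E (?P h) (\<lambda>zs. \<Sum>a\<in>A. pmf (\<pi> h) a * ((a - Astar zs) \<bullet> loss (zs ! t))) = G t h"
        if h: "h \<in> set_pmf (?H t)" for h
        unfolding G_def exp_gap_def
        by (subst Bochner_Integration.integral_sum)
           (simp_all add: integrable_measure_pmf_finite[OF post(1)[OF h]])
      thus "?E (joint_pmf \<Phi> \<mu> \<pi> t) (\<lambda>(zs, h). \<Sum>a\<in>A. pmf (\<pi> h) a * ((a - Astar zs) \<bullet> loss (zs ! t)))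
          = ?E (?H t) (G t)"
        unfolding expectation_joint_posterior[OF fin] prod.case by (rule expectation_cong_pmf)
    qed
    finally show ?thesis .
  qed
  finally show ?thesis using G_sum by (simp add: dm_def)
qed

end
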